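(* Let $n=n_1n_2$ be a square-free odd integer which is divisible by neither $7$ nor $13$, where $n_1=\prod_{i=1}^r p_i$ and $n_2=\prod_{j=1}^s q_j$ with primes $p_i\equiv 1 \pmod 3$ and $q_j\equiv 2\pmod 3$. Let $T_n=\{a^3 \bmod n : a\in\mathbb{Z}_n^*\}$. Then (i) $D_{T_n}(\mathbb{Z}_n)=2\Omega(n_1)+\Omega(n_2)+1$, and (ii) $\mathsf{E}_{T_n}(\mathbb{Z}_n)=n+2\Omega(n_1)+\Omega(n_2)$.
   Context: $\mathbb{Z}_n=\mathbb{Z}/n\mathbb{Z}$ and $\mathbb{Z}_n^*$ is its group of units. $\Omega(m)$ denotes the number of prime factors of $m$ counted with multiplicity. A sequence over $\mathbb{Z}_n$ is a finite unordered list (multiset) $x_1\cdot x_2\cdots x_k$ of elements of $\mathbb{Z}_n$; a subsequence is a sub-multiset. For a nonempty set of weights $A\subseteq \mathbb{Z}_n$ (residues viewed as integers in $[1,n-1]$), a sequence $x_1\cdots x_k$ is an $A$-weighted zero-sum sequence if there exist $a_1,\dots,a_k\in A$ with $\sum_{i=1}^k a_ix_i=0$ in $\mathbb{Z}_n$. $D_A(\mathbb{Z}_n)$ is the least positive integer $\ell$ such that every sequence over $\mathbb{Z}_n$ of length $\ell$ has a non-empty $A$-weighted zero-sum subsequence. $\mathsf{E}_A(\mathbb{Z}_n)$ is the least positive integer $\ell$ such that every sequence over $\mathbb{Z}_n$ of length $\ell$ has an $A$-weighted zero-sum subsequence of length $n$. *)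

theory Defs
  imports "HOL-Number_Theory.Number_Theory" "HOL-Computational_Algebra.Squarefree"
begin

text \<open>
  Elements of \<open>\<int>/n\<int>\<close> are represented by their least non-negative residues, so that a sequence
  over \<open>\<int>/n\<int>\<close> is a multiset of such residues.
\<close>

definition Zmod :: "nat \<Rightarrow> int set" where
  "Zmod n = {0..<int n}"

definition Omega :: "nat \<Rightarrow> nat" where
  "Omega m = size (prime_factorization m)"

text \<open>
  The list \<open>xs\<close> is an arbitrary enumeration of the multiset \<open>S\<close>; in this way, equal terms of
  \<open>S\<close> may receive different weights.
\<close>

definition weighted_zero_sum :: "nat \<Rightarrow> int set \<Rightarrow> int multiset \<Rightarrow> bool" where
  "weighted_zero_sum n A S \<longleftrightarrow>
     (\<exists>xs ws. mset xs = S \<and> length ws = length xs \<and> set ws \<subseteq> A \<and>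
        [(\<Sum>i<length xs. ws ! i * xs ! i) = 0] (mod int n))"

definition weighted_Davenport :: "nat \<Rightarrow> int set \<Rightarrow> nat" where
  "weighted_Davenport n A =
     (LEAST l. 0 < l \<and>
        (\<forall>S. set_mset S \<subseteq> Zmod n \<and> size S = l \<longrightarrow>
           (\<exists>S'. S' \<subseteq># S \<and> S' \<noteq> {#} \<and> weighted_zero_sum n A S')))"

definition weighted_EGZ :: "nat \<Rightarrow> int set \<Rightarrow> nat" where
  "weighted_EGZ n A =
     (LEAST l. 0 < l \<and>
        (\<forall>S. set_mset S \<subseteq> Zmod n \<and> size S = l \<longrightarrow>
           (\<exists>S'. S' \<subseteq># S \<and> size S' = n \<and> weighted_zero_sum n A S')))"

text \<open>
  The residues coprime to \<open>n\<close> represent the units of \<open>\<int>/n\<int>\<close>. For \<open>n = 1\<close> the zero ring has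
  the single unit \<open>0\<close>, and the set below is \<open>{0}\<close>.
\<close>

definition unit_cubes :: "nat \<Rightarrow> int set" where
  "unit_cubes n = {a ^ 3 mod int n | a. a \<in> Zmod n \<and> coprime a (int n)}"

end

theory Submission
  imports Defs
begin

text \<open>
  For a prime \<open>p \<equiv> 1 (mod 3)\<close> other than \<open>7\<close> and \<open>13\<close>, the cyclotomic numbers of order three are all
  nonzero: they satisfy two linear relations and, from counting the solutions of
  \<open>u\<^sup>3 + v\<^sup>3 + g w\<^sup>3 + g z\<^sup>3 = 0\<close> in two ways, Gauss's quadratic relation, and these leave no room for
  a zero once \<open>p > 16\<close>. Hence every unit modulo \<open>p\<close> has the form \<open>a u\<^sup>3 + b v\<^sup>3\<close> with units \<open>u\<close>, \<open>v\<close>, for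
  any given units \<open>a\<close>, \<open>b\<close>, and three nonzero terms suffice to make a sequence a cube-weighted
  zero-sum modulo \<open>p\<close>. If \<open>p \<equiv> 2 (mod 3)\<close>, all units are cubes and two nonzero terms suffice.

  From \<open>n + 2 \<Omega>(n\<^sub>1) + \<Omega>(n\<^sub>2)\<close> terms one can discard at most two for each \<open>p\<^sub>i\<close> and one for each \<open>q\<^sub>j\<close> so
  that modulo each prime either no nonzero term is left or sufficiently many are; the Chinese
  remainder theorem combines the primes. Conversely, the terms \<open>n / p\<^sub>i\<close>, \<open>g\<^sub>i n / p\<^sub>i\<close> (with \<open>g\<^sub>i\<close> not a
  cube modulo \<open>p\<^sub>i\<close>) and \<open>n / q\<^sub>j\<close>, padded with zeros, give the lower bounds.
\<close>

section \<open>Counting values of binary diagonal cubic forms\<close>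

text \<open>Keeping \<open>t\<close> on the same side as the cubes makes the count symmetric in
  \<open>a\<close>, \<open>b\<close>, \<open>t\<close> for prime \<open>p\<close>. Integer values
  allow the later relations to be solved by subtraction.\<close>

definition pair_count :: "int \<Rightarrow> int \<Rightarrow> int \<Rightarrow> int \<Rightarrow> int" where
  "pair_count p a b t = (\<Sum>u\<in>{1..<p}. \<Sum>v\<in>{1..<p}. of_bool (p dvd a * u ^ 3 + b * v ^ 3 + t))"

section \<open>Reindexing sums over the units modulo a prime\<close>

lemma unit_inverse:
  fixes p s :: int
  assumes "prime p" "\<not> p dvd s"
  obtains s' where "[s * s' = 1] (mod p)" "\<not> p dvd s'"
proof -
  have "coprime s p"
    using assms by (metis coprime_commute prime_imp_coprime)
  then obtain s' where s': "[s * s' = 1] (mod p)"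
    using cong_solve_coprime_int by blast
  moreover have "\<not> p dvd s'"
  proof
    assume "p dvd s'"
    then have "p dvd 1"
      using cong_dvd_iff[OF s'] by simp
    then show False
      using assms(1) not_prime_unit by blast
  qed
  ultimately show thesis
    using that by blast
qed

lemma mod_unit_range:
  fixes p s :: int
  assumes "prime p" "\<not> p dvd s"
  shows "s mod p \<in> {1..<p}"
proof -
  have "p > 0"
    using assms(1) by (rule prime_gt_0_int)
  then have "0 \<le> s mod p" "s mod p < p"
    by simp_all
  moreover have "s mod p \<noteq> 0"
    using assms(2) by (simp add: dvd_eq_mod_eq_0)
  ultimately show ?thesis
    unfolding atLeastLessThan_iff by linarith
qed

lemma range_not_dvd:
  fixes p u :: int
  assumes "u \<in> {1..<p}"
  shows "\<not> p dvd u"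
  using assms zdvd_imp_le by fastforce

text \<open>Multiplication by a unit permutes the nonzero residues. Since \<open>s * u\<close> is
  left unreduced, \<open>per\<close> expresses that \<open>F\<close> depends only on the
  residue.\<close>

lemma sum_units_mult:
  fixes p s :: int and F :: "int \<Rightarrow> int"
  assumes p: "prime p" and s: "\<not> p dvd s" and per: "\<And>u. F (u mod p) = F u"
  shows "(\<Sum>u\<in>{1..<p}. F (s * u)) = (\<Sum>u\<in>{1..<p}. F u)"
proof -
  obtain s' where s': "[s * s' = 1] (mod p)" "\<not> p dvd s'"
    using unit_inverse[OF p s] .
  have eq: "s * (s' * u) mod p = u" "s' * (s * u) mod p = u" if "u \<in> {1..<p}" for u
  proof -
    have "[(s * s') * u = 1 * u] (mod p)"
      by (intro cong_mult s' cong_refl)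
    then have "(s * s') * u mod p = u"
      using that by (simp add: cong_def)
    then show "s * (s' * u) mod p = u" "s' * (s * u) mod p = u"
      by (simp_all add: mult.assoc mult.left_commute)
  qed
  have unit: "x * u mod p \<in> {1..<p}" if "\<not> p dvd x" "u \<in> {1..<p}" for x u
    by (rule mod_unit_range[OF p]) (use that p range_not_dvd[of u p] in \<open>auto simp: prime_dvd_mult_iff\<close>)
  show ?thesis
    by (rule sum.reindex_bij_witness[where i = "\<lambda>u. s' * u mod p" and j = "\<lambda>u. s * u mod p"])
       (use eq unit s s' per in \<open>simp_all add: mod_mult_right_eq\<close>)
qed

text \<open>Inversion is an involution on the nonzero residues; any choice \<open>h\<close> of
  inverses will do, reduced or not.\<close>

lemma sum_units_inverse:
  fixes p :: int and F :: "int \<Rightarrow> int" and h :: "int \<Rightarrow> int"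
  assumes p: "prime p" and per: "\<And>u. F (u mod p) = F u"
    and h: "\<And>u. \<not> p dvd u \<Longrightarrow> [u * h u = 1] (mod p)"
  shows "(\<Sum>u\<in>{1..<p}. F (h u)) = (\<Sum>u\<in>{1..<p}. F u)"
proof -
  have unit: "\<not> p dvd h u" if "\<not> p dvd u" for u
  proof
    assume "p dvd h u"
    then have "p dvd 1"
      using cong_dvd_iff[OF h[OF that]] by simp
    then show False
      using p not_prime_unit by blast
  qed
  have inv: "h (h u mod p) mod p = u" if u: "u \<in> {1..<p}" for u
  proof -
    let ?v = "h u mod p"
    have nu: "\<not> p dvd u"
      using u by (rule range_not_dvd)
    have 1: "[u * ?v = 1] (mod p)"
      using h[OF nu] by (simp add: cong_def mod_mult_right_eq)
    have "?v \<in> {1..<p}"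
      using mod_unit_range[OF p unit[OF nu]] .
    then have 2: "[?v * h ?v = 1] (mod p)"
      by (intro h range_not_dvd)
    have "[u * (?v * h ?v) = u * 1] (mod p)"
      by (intro cong_mult 2 cong_refl)
    moreover have "[(u * ?v) * h ?v = 1 * h ?v] (mod p)"
      by (intro cong_mult 1 cong_refl)
    ultimately have "[h ?v = u] (mod p)"
      by (simp add: mult.assoc) (metis cong_sym cong_trans)
    then show ?thesis
      using u by (simp add: cong_def)
  qed
  have "h u mod p \<in> {1..<p}" if "u \<in> {1..<p}" for u
    using mod_unit_range[OF p unit[OF range_not_dvd[OF that]]] .
  then show ?thesis
    by (intro sum.reindex_bij_witness[where i = "\<lambda>u. h u mod p" and j = "\<lambda>u. h u mod p"])
       (use inv per in simp_all)
qed

section \<open>Invariances of the pair count\<close>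

lemma of_bool_dvd_cong:
  fixes x y p :: int
  assumes "[x = y] (mod p)"
  shows "(of_bool (p dvd x) :: int) = of_bool (p dvd y)"
  using cong_dvd_iff[OF assms] by simp

lemma pair_count_cong:
  assumes "[a = a'] (mod p)" "[b = b'] (mod p)" "[t = t'] (mod p)"
  shows "pair_count p a b t = pair_count p a' b' t'"
  unfolding pair_count_def
  by (intro sum.cong refl of_bool_dvd_cong cong_add cong_mult assms cong_refl)

lemma pair_count_commute: "pair_count p a b t = pair_count p b a t"
  unfolding pair_count_def by (subst sum.swap) (simp add: add.commute)

lemma pair_count_scale:
  assumes "prime p" "\<not> p dvd s"
  shows "pair_count p (s * a) (s * b) (s * t) = pair_count p a b t"
proof -
  have "p dvd s * a * u ^ 3 + s * b * v ^ 3 + s * t \<longleftrightarrow> p dvd a * u ^ 3 + b * v ^ 3 + t" for u v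
  proof -
    have "s * a * u ^ 3 + s * b * v ^ 3 + s * t = s * (a * u ^ 3 + b * v ^ 3 + t)"
      by (simp add: algebra_simps)
    then show ?thesis
      using assms by (simp add: prime_dvd_mult_iff)
  qed
  then show ?thesis
    by (simp add: pair_count_def)
qed

text \<open>Dividing the equation by \<open>u ^ 3\<close> gives one of the same shape in
  \<open>1 / u\<close> and \<open>v / u\<close>, with the roles of \<open>a\<close> and
  \<open>t\<close> exchanged.\<close>

lemma pair_count_rotate:
  assumes p: "prime p"
  shows "pair_count p a b t = pair_count p t b a"
proof -
  define h where "h u = (SOME s. [u * s = 1] (mod p))" for u
  have h: "[u * h u = 1] (mod p)" if "\<not> p dvd u" for u
    unfolding h_def by (rule someI_ex) (use unit_inverse[OF p that] in blast)
  have "pair_count p t b a =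
      (\<Sum>u\<in>{1..<p}. \<Sum>v\<in>{1..<p}. of_bool (p dvd a * h u ^ 3 + b * v ^ 3 + t))"
    unfolding pair_count_def
  proof (rule sum.cong[OF refl])
    fix u assume u: "u \<in> {1..<p}"
    have nu: "\<not> p dvd u"
      using u by (rule range_not_dvd)
    \<comment> \<open>Replacing \<open>v\<close> by \<open>u * v\<close> makes \<open>u ^ 3\<close>
      a common factor of the first two terms; it is then cancelled by means of the inverse
      \<open>h u\<close>.\<close>
    have "(\<Sum>v\<in>{1..<p}. of_bool (p dvd t * u ^ 3 + b * v ^ 3 + a) :: int) =
        (\<Sum>v\<in>{1..<p}. of_bool (p dvd t * u ^ 3 + b * (u * v) ^ 3 + a))"
      by (rule sum_units_mult[OF p nu, symmetric])
         (intro of_bool_dvd_cong cong_add cong_mult cong_pow cong_refl cong_mod_leftI)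
    also have "\<dots> = (\<Sum>v\<in>{1..<p}. of_bool (p dvd a * h u ^ 3 + b * v ^ 3 + t))"
    proof (intro sum.cong refl)
      fix v
      have "[(u * h u) ^ 3 = 1 ^ 3] (mod p)"
        by (intro cong_pow h nu)
      then have "[u ^ 3 * (t + b * v ^ 3) + a * (u * h u) ^ 3 = u ^ 3 * (t + b * v ^ 3) + a * 1] (mod p)"
        by (intro cong_add cong_mult cong_refl) simp
      then have "p dvd t * u ^ 3 + b * (u * v) ^ 3 + a \<longleftrightarrow>
          p dvd u ^ 3 * (a * h u ^ 3 + b * v ^ 3 + t)"
        using cong_dvd_iff by (fastforce simp: algebra_simps power_mult_distrib)
      also have "\<dots> \<longleftrightarrow> p dvd a * h u ^ 3 + b * v ^ 3 + t"
        using p nu by (simp add: prime_dvd_mult_iff prime_dvd_power_iff)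
      finally show "(of_bool (p dvd t * u ^ 3 + b * (u * v) ^ 3 + a) :: int) =
          of_bool (p dvd a * h u ^ 3 + b * v ^ 3 + t)"
        by simp
    qed
    finally show "(\<Sum>v\<in>{1..<p}. of_bool (p dvd t * u ^ 3 + b * v ^ 3 + a) :: int) =
        (\<Sum>v\<in>{1..<p}. of_bool (p dvd a * h u ^ 3 + b * v ^ 3 + t))" .
  qed
  also have "\<dots> = pair_count p a b t"
    unfolding pair_count_def
    by (rule sum_units_inverse[OF p _ h, where F = "\<lambda>w. \<Sum>v\<in>{1..<p}. of_bool (p dvd a * w ^ 3 + b * v ^ 3 + t)"])
       (intro sum.cong refl of_bool_dvd_cong cong_add cong_mult cong_pow cong_refl cong_mod_leftI)
  finally show ?thesis ..
qed

text \<open>Substituting \<open>s * u\<close> for \<open>u\<close> absorbs the cube, so only the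
  cubic class of a coefficient matters.\<close>

lemma pair_count_cube:
  assumes p: "prime p" and s: "\<not> p dvd s"
  shows "pair_count p (a * s ^ 3) b t = pair_count p a b t"
proof -
  let ?F = "\<lambda>u. \<Sum>v\<in>{1..<p}. of_bool (p dvd a * u ^ 3 + b * v ^ 3 + t) :: int"
  have "(\<Sum>u\<in>{1..<p}. ?F (s * u)) = (\<Sum>u\<in>{1..<p}. ?F u)"
    by (rule sum_units_mult[OF p s])
       (intro sum.cong refl of_bool_dvd_cong cong_add cong_mult cong_pow cong_refl cong_mod_leftI)
  then show ?thesis
    unfolding pair_count_def by (simp only: power_mult_distrib mult.assoc)
qed

lemma pair_count_cube':
  assumes p: "prime p" and s: "\<not> p dvd s"
  shows "pair_count p a (b * s ^ 3) t = pair_count p a b t"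
    and "pair_count p a b (t * s ^ 3) = pair_count p a b t"
  using pair_count_cube[OF assms] pair_count_commute pair_count_rotate[OF p] by metis+

section \<open>Cubic residue classes\<close>

lemma fermat_int:
  fixes p :: nat and u :: int
  assumes p: "prime p" and u: "\<not> int p dvd u"
  shows "[u ^ (p - 1) = 1] (mod int p)"
proof -
  define x where "x = nat (u mod int p)"
  have x: "int x = u mod int p"
    using p by (simp add: x_def prime_gt_0_nat)
  have "\<not> p dvd x"
    using u x by (metis dvd_mod_iff int_dvd_int_iff dvd_refl)
  then have "[x ^ (p - 1) = 1] (mod p)"
    by (rule fermat_theorem[OF p])
  then have "[int x ^ (p - 1) = 1] (mod int p)"
    by (metis cong_int_iff of_nat_1 of_nat_power)
  then show ?thesis
    by (simp add: x cong_def power_mod)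
qed

text \<open>A primitive root serves as \<open>g\<close>: reducing its exponents modulo 3 leaves the
  classes of \<open>1\<close>, \<open>g\<close> and \<open>g ^ 2\<close>. The last clause holds
  because \<open>- 1\<close> is a cube and \<open>g\<close> is not.\<close>

lemma cubic_class_representatives:
  fixes p :: nat
  assumes p: "prime p" and p3: "p mod 3 = 1"
  obtains g :: int where "\<not> int p dvd g"
    and "\<And>t. \<not> int p dvd t \<Longrightarrow>
      \<exists>s k. \<not> int p dvd s \<and> k < (3::nat) \<and> [t = g ^ k * s ^ 3] (mod int p)"
    and "\<And>u v. \<not> int p dvd u \<Longrightarrow> \<not> int p dvd u ^ 3 + g * v ^ 3"
proof -
  have p1: "p > 1"
    using p by (rule prime_gt_1_nat)
  obtain G where G: "residue_primroot p G"
    using prime_primitive_root_exists[OF p1 p] by blast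
  have ord: "ord p G = p - 1" and cop: "coprime p G"
    using G p by (auto simp: residue_primroot_def totient_prime)
  define g where "g = int G"
  have pG: "\<not> p dvd G"
    using cop p by (metis coprime_absorb_left not_prime_unit)
  then have g: "\<not> int p dvd g"
    by (simp add: g_def)
  have pg: "\<not> int p dvd g ^ j" for j
    using g p prime_dvd_power[of "int p" g j] by auto
  show thesis
  proof
    show "\<not> int p dvd g"
      by (rule g)
  next
    fix t :: int assume t: "\<not> int p dvd t"
    define x where "x = nat (t mod int p)"
    have tx: "t mod int p \<in> {1..<int p}"
      using t p by (intro mod_unit_range) auto
    then have x: "int x = t mod int p" "x < p" "x > 0"
      by (auto simp: x_def)
    then have "x \<in> totatives p"
      using p by (auto simp: totatives_prime)
    then obtain i where "x = G ^ i mod p"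
      using residue_primroot_is_generator[OF p1 G] by (auto simp: bij_betw_def)
    then have "[t = g ^ i] (mod int p)"
      using x by (simp add: cong_def g_def zmod_int)
    also have "g ^ i = g ^ (i mod 3) * (g ^ (i div 3)) ^ 3"
      by (simp flip: power_mult power_add)
    finally show "\<exists>s k. \<not> int p dvd s \<and> k < (3::nat) \<and> [t = g ^ k * s ^ 3] (mod int p)"
      using pg by (intro exI[of _ "g ^ (i div 3)"] exI[of _ "i mod 3"]) simp
  next
    fix u v :: int assume u: "\<not> int p dvd u"
    show "\<not> int p dvd u ^ 3 + g * v ^ 3"
    proof
      assume d: "int p dvd u ^ 3 + g * v ^ 3"
      \<comment> \<open>Raising to the power \<open>k\<close> turns nonzero cubes into 1 by Fermat,
        and the evenness of \<open>k\<close> removes the sign. Hence \<open>g ^ k\<close> would be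
        1, against the order \<open>p - 1\<close> of \<open>g\<close>.\<close>
      define k where "k = (p - 1) div 3"
      have k: "p - 1 = 3 * k"
        using p3 p1 unfolding k_def by presburger
      have "p \<noteq> 2"
        using p3 by auto
      then have "odd p"
        using p p1 primes_dvd_imp_eq two_is_prime_nat by blast
      then have "even k"
        using k p1 by presburger
      have v: "\<not> int p dvd v"
      proof
        assume "int p dvd v"
        then have "int p dvd g * v ^ 3"
          by (simp add: power3_eq_cube)
        then have "int p dvd u ^ 3"
          using d dvd_add_left_iff by blast
        then show False
          using u p prime_dvd_power[of "int p" u 3] by auto
      qed
      have "[g * v ^ 3 = - (u ^ 3)] (mod int p)"
        using d by (simp add: cong_iff_dvd_diff add.commute)
      then have "[(g * v ^ 3) ^ k = (- (u ^ 3)) ^ k] (mod int p)"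
        by (rule cong_pow)
      then have "[g ^ k * v ^ (p - 1) = u ^ (p - 1)] (mod int p)"
        unfolding k using \<open>even k\<close> by (simp add: power_mult power_mult_distrib)
      moreover have "[g ^ k * v ^ (p - 1) = g ^ k * 1] (mod int p)"
        by (intro cong_mult cong_refl fermat_int p v)
      moreover have "[u ^ (p - 1) = 1] (mod int p)"
        by (intro fermat_int p u)
      ultimately have "[g ^ k = 1] (mod int p)"
        by (metis cong_sym cong_trans mult.right_neutral)
      then have "[G ^ k = 1] (mod p)"
        unfolding g_def by (metis cong_int_iff of_nat_1 of_nat_power)
      moreover have "0 < k" "k < p - 1"
        using k p1 by auto
      ultimately show False
        using ord_minimal[of k p G] ord by simp
    qed
  qed
qed

text \<open>\<open>F\<close> is constant on cubic classes, and \<open>t\<close>,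
  \<open>g * t\<close>, \<open>g ^ 2 * t\<close> represent the three classes in some order. Adding
  to the sum its shifts by \<open>g\<close> and \<open>g ^ 2\<close> replaces counting the class
  sizes.\<close>

lemma sum_units_class_function:
  fixes p g :: int and F :: "int \<Rightarrow> int"
  assumes p: "prime p" and g: "\<not> p dvd g"
    and repr: "\<And>t. \<not> p dvd t \<Longrightarrow> \<exists>s k. \<not> p dvd s \<and> k < (3::nat) \<and> [t = g ^ k * s ^ 3] (mod p)"
    and per: "\<And>t t'. [t = t'] (mod p) \<Longrightarrow> F t = F t'"
    and cube: "\<And>t s. \<not> p dvd s \<Longrightarrow> F (t * s ^ 3) = F t"
  shows "3 * (\<Sum>t\<in>{1..<p}. F t) = (p - 1) * (F 1 + F g + F (g ^ 2))"
proof -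
  have per': "F (t mod p) = F t" for t
    by (rule per) simp
  have g2: "\<not> p dvd g ^ 2"
    using p g by (simp add: prime_dvd_power_iff)
  have orbit: "F t + F (g * t) + F (g ^ 2 * t) = F 1 + F g + F (g ^ 2)" if t: "t \<in> {1..<p}" for t
  proof -
    obtain s k where s: "\<not> p dvd s" "k < (3::nat)" "[t = g ^ k * s ^ 3] (mod p)"
      using repr[OF range_not_dvd[OF t]] by blast
    have eq: "F (g ^ j * t) = F (g ^ (j + k))" for j
    proof -
      have "F (g ^ j * t) = F (g ^ j * (g ^ k * s ^ 3))"
        by (intro per cong_mult cong_refl s)
      also have "\<dots> = F (g ^ (j + k))"
        using cube[OF s(1), of "g ^ (j + k)"] by (simp add: power_add mult.assoc)
      finally show ?thesis .
    qed
    have eq3: "F (g ^ (j + 3)) = F (g ^ j)" for j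
      using cube[OF g, of "g ^ j"] by (simp add: power_add)
    consider "k = 0" | "k = 1" | "k = 2"
      using s(2) by linarith
    then show ?thesis
      using eq[of 0] eq[of 1] eq[of 2] eq3[of 0] eq3[of 1]
      by cases (simp_all add: numeral_eq_Suc)
  qed
  have "3 * (\<Sum>t\<in>{1..<p}. F t) =
      (\<Sum>t\<in>{1..<p}. F t) + (\<Sum>t\<in>{1..<p}. F (g * t)) + (\<Sum>t\<in>{1..<p}. F (g ^ 2 * t))"
    using sum_units_mult[where F = F, OF p g per'] sum_units_mult[where F = F, OF p g2 per'] by simp
  also have "\<dots> = (\<Sum>t\<in>{1..<p}. F 1 + F g + F (g ^ 2))"
    unfolding sum.distrib[symmetric] by (rule sum.cong[OF refl orbit])
  also have "\<dots> = (p - 1) * (F 1 + F g + F (g ^ 2))"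
    using prime_gt_1_int[OF p] by simp
  finally show ?thesis .
qed

section \<open>Linear and quadratic relations between the counts\<close>

lemma sum_residues_indicator:
  fixes p X :: int
  assumes p: "p > 0"
  shows "(\<Sum>t\<in>{0..<p}. of_bool (p dvd X + t) * F t :: int) = F ((- X) mod p)"
proof -
  have "p dvd X + t \<longleftrightarrow> t = (- X) mod p" if "t \<in> {0..<p}" for t
  proof -
    have "p dvd X + t \<longleftrightarrow> [t = - X] (mod p)"
      by (simp add: cong_iff_dvd_diff add.commute)
    then show ?thesis
      using that by (simp add: cong_def)
  qed
  then have "(\<Sum>t\<in>{0..<p}. of_bool (p dvd X + t) * F t) =
      (\<Sum>t\<in>{0..<p}. if t = (- X) mod p then F t else 0)"
    by (intro sum.cong) auto
  then show ?thesis
    using p by simp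
qed

text \<open>Each pair \<open>(u, v)\<close> is a solution for exactly one residue \<open>t\<close>;
  the term \<open>t = 0\<close> is split off.\<close>

lemma sum_pair_count:
  assumes p: "prime p"
  shows "(\<Sum>t\<in>{1..<p}. pair_count p a b t) = (p - 1) ^ 2 - pair_count p a b 0"
proof -
  have p1: "p > 1"
    using p by (rule prime_gt_1_int)
  have "(\<Sum>t\<in>{0..<p}. pair_count p a b t) =
      (\<Sum>u\<in>{1..<p}. \<Sum>v\<in>{1..<p}. \<Sum>t\<in>{0..<p}. of_bool (p dvd a * u ^ 3 + b * v ^ 3 + t))"
    unfolding pair_count_def by (subst sum.swap, rule sum.cong[OF refl], subst sum.swap, rule refl)
  also have "\<dots> = (\<Sum>u\<in>{1..<p}. \<Sum>v\<in>{1..<p}. 1)"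
    using sum_residues_indicator[of p _ "\<lambda>_. 1"] p1 by simp
  also have "\<dots> = (p - 1) ^ 2"
    using p1 by (simp add: power2_eq_square)
  finally have "(\<Sum>t\<in>{0..<p}. pair_count p a b t) = (p - 1) ^ 2" .
  moreover have "{0..<p} = insert 0 {1..<p}"
    using p1 by auto
  ultimately show ?thesis
    by simp
qed

text \<open>
  Both sides count the solutions of \<open>a u\<^sup>3 + b v\<^sup>3 + c w\<^sup>3 + d z\<^sup>3 = 0\<close> in units; the two ways of
  pairing the four terms give the quadratic relation between the counts.
\<close>

lemma sum_pair_count_mult:
  assumes p: "prime p"
  shows "(\<Sum>t\<in>{0..<p}. pair_count p a b t * pair_count p c d (- t)) =
    (\<Sum>t\<in>{0..<p}. pair_count p a c t * pair_count p b d (- t))"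
proof -
  have p0: "p > 0"
    using p by (rule prime_gt_0_int)
  define q where "q a b c d = (\<Sum>u\<in>{1..<p}. \<Sum>v\<in>{1..<p}. \<Sum>w\<in>{1..<p}. \<Sum>z\<in>{1..<p}.
    of_bool (p dvd a * u ^ 3 + b * v ^ 3 + c * w ^ 3 + d * z ^ 3) :: int)" for a b c d
  have *: "(\<Sum>t\<in>{0..<p}. pair_count p a b t * pair_count p c d (- t)) = q a b c d" for a b c d
  proof -
    have "(\<Sum>t\<in>{0..<p}. pair_count p a b t * pair_count p c d (- t)) =
       (\<Sum>t\<in>{0..<p}. \<Sum>u\<in>{1..<p}. \<Sum>v\<in>{1..<p}.
         of_bool (p dvd a * u ^ 3 + b * v ^ 3 + t) * pair_count p c d (- t))"
      by (simp only: pair_count_def[of p a b] sum_distrib_right)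
    also have "\<dots> = (\<Sum>u\<in>{1..<p}. \<Sum>v\<in>{1..<p}. \<Sum>t\<in>{0..<p}.
         of_bool (p dvd a * u ^ 3 + b * v ^ 3 + t) * pair_count p c d (- t))"
      by (subst sum.swap, rule sum.cong[OF refl], subst sum.swap, rule refl)
    \<comment> \<open>For fixed \<open>u\<close> and \<open>v\<close>, only the residue of
      \<open>- (a * u ^ 3 + b * v ^ 3)\<close> contributes to the sum over \<open>t\<close>.\<close>
    also have "\<dots> = (\<Sum>u\<in>{1..<p}. \<Sum>v\<in>{1..<p}. pair_count p c d (a * u ^ 3 + b * v ^ 3))"
    proof (rule sum.cong[OF refl], rule sum.cong[OF refl])
      fix u v
      let ?X = "a * u ^ 3 + b * v ^ 3"
      have "(\<Sum>t\<in>{0..<p}. of_bool (p dvd ?X + t) * pair_count p c d (- t)) =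
          pair_count p c d (- ((- ?X) mod p))"
        by (rule sum_residues_indicator[OF p0])
      also have "\<dots> = pair_count p c d ?X"
        by (intro pair_count_cong cong_refl) (simp add: cong_def mod_minus_eq add.commute)
      finally show "(\<Sum>t\<in>{0..<p}. of_bool (p dvd ?X + t) * pair_count p c d (- t)) =
          pair_count p c d ?X" .
    qed
    also have "\<dots> = q a b c d"
      unfolding pair_count_def q_def by (simp add: algebra_simps)
    finally show ?thesis .
  qed
  have "q a b c d = q a c b d"
    unfolding q_def by (rule sum.cong[OF refl], subst sum.swap) (simp add: algebra_simps)
  then show ?thesis
    by (simp add: *)
qed

lemma pair_count_nonneg: "pair_count p a b t \<ge> 0"
  unfolding pair_count_def by (intro sum_nonneg) simp

lemma pair_count_nonzeroD:
  assumes "pair_count p a b t \<noteq> 0"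
  obtains u v where "u \<in> {1..<p}" "v \<in> {1..<p}" "p dvd a * u ^ 3 + b * v ^ 3 + t"
proof -
  have "\<exists>u\<in>{1..<p}. \<exists>v\<in>{1..<p}. p dvd a * u ^ 3 + b * v ^ 3 + t"
  proof (rule ccontr)
    assume "\<not> ?thesis"
    then have "pair_count p a b t = 0"
      unfolding pair_count_def by (intro sum.neutral ballI) auto
    then show False
      using assms by simp
  qed
  then show thesis
    using that by blast
qed

text \<open>
  The integers \<open>\<alpha>\<close>, \<open>\<beta>\<close>, \<open>\<gamma>\<close>, \<open>\<delta>\<close> will be nine times the cyclotomic numbers of order three, and
  \<open>m\<close> will be \<open>p - 1\<close>. Among the primes \<open>p \<equiv> 1 (mod 3)\<close>, the bound on
  \<open>m\<close> excludes only \<open>7\<close> and \<open>13\<close>.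
\<close>

lemma cyclotomic_arith:
  fixes \<alpha> \<beta> \<gamma> \<delta> m :: int
  assumes nonneg: "\<alpha> \<ge> 0" "\<beta> \<ge> 0" "\<gamma> \<ge> 0"
    and sum1: "\<alpha> + \<beta> + \<gamma> = 3 * m - 9" and sum2: "\<beta> + \<gamma> + \<delta> = 3 * m"
    and quad: "27 * m + \<alpha> * \<gamma> + \<beta> * \<alpha> + \<gamma> * \<beta> = \<beta> ^ 2 + \<gamma> ^ 2 + \<delta> ^ 2"
    and m: "m > 15"
  shows "\<alpha> \<noteq> 0" "\<beta> \<noteq> 0" "\<gamma> \<noteq> 0" "\<delta> \<noteq> 0"
proof -
  have \<delta>: "\<delta> = \<alpha> + 9"
    using sum1 sum2 by linarith
  then show "\<delta> \<noteq> 0"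
    using nonneg by linarith
  show "\<alpha> \<noteq> 0"
  proof
    assume "\<alpha> = 0"
    then have "\<gamma> = 3 * m - 9 - \<beta>" "27 * m + \<gamma> * \<beta> = \<beta> ^ 2 + \<gamma> ^ 2 + 81"
      using sum1 quad \<delta> by simp_all
    then have "27 * m + (3 * m - 9 - \<beta>) * \<beta> = \<beta> ^ 2 + (3 * m - 9 - \<beta>) ^ 2 + 81"
      by simp
    \<comment> \<open>Completing the square; the bound on \<open>m\<close> makes the remaining
      product positive.\<close>
    then have "(2 * \<beta> - (3 * m - 9)) ^ 2 * 3 + (3 * m - 9) * (3 * m - 45) = 0"
      by (simp add: power2_eq_square algebra_simps)
    moreover have "(3 * m - 9) * (3 * m - 45) > 0"
      using m by (intro mult_pos_pos) linarith+
    ultimately show False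
      using zero_le_power2[of "2 * \<beta> - (3 * m - 9)"] by linarith
  qed
  \<comment> \<open>The cases \<open>\<beta> = 0\<close> and \<open>\<gamma> = 0\<close> are alike,
    with \<open>x\<close> the other of the two. Writing \<open>27 * m\<close> as
    \<open>9 * x + 9 * \<delta>\<close> gives a quadratic equation in \<open>\<delta>\<close> with
    discriminant \<open>(9 + x) ^ 2 - 4 * x ^ 2\<close>. This forces \<open>x \<le> 9\<close>, and
    then \<open>\<delta> = 3 * m - x\<close> is too large to be a root.\<close>
  have False if "x \<ge> 0" "\<alpha> + x = 3 * m - 9" "27 * m + \<alpha> * x = x ^ 2 + \<delta> ^ 2" for x
  proof -
    have x: "x = 3 * m - \<delta>"
      using that(2) \<delta> by linarith
    have "\<delta> * x = \<alpha> * x + 9 * x"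
      unfolding \<delta> by (simp add: distrib_right)
    then have "9 * \<delta> + \<delta> * x = x ^ 2 + \<delta> ^ 2"
      using that(3) x by linarith
    then have 1: "(2 * \<delta> - (9 + x)) ^ 2 = (9 + x) ^ 2 - 4 * x ^ 2"
      by (simp add: power2_eq_square algebra_simps)
    have "x \<le> 9"
    proof (rule ccontr)
      assume "\<not> x \<le> 9"
      then have "(9 + x) ^ 2 < (2 * x) ^ 2"
        by (intro power_strict_mono) auto
      then show False
        using 1 zero_le_power2[of "2 * \<delta> - (9 + x)"] by (simp add: power_mult_distrib)
    qed
    then have "(x + 9) ^ 2 \<le> 18 ^ 2"
      using that(1) by (intro power_mono) auto
    moreover have "18 ^ 2 < (2 * \<delta> - (9 + x)) ^ 2"
      using x m \<open>x \<le> 9\<close> by (intro power_strict_mono) auto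
    ultimately show False
      using 1 zero_le_power2[of x] by (simp add: add.commute)
  qed
  note contr = this
  show "\<beta> \<noteq> 0"
    using contr[of \<gamma>] nonneg sum1 quad by auto
  show "\<gamma> \<noteq> 0"
    using contr[of \<beta>] nonneg sum1 quad by (auto simp: mult.commute)
qed

section \<open>Positivity of the counts and representation of units\<close>

text \<open>Only the cubic classes of the coefficients matter, up to permutation and a common shift.
  This leaves four counts, which satisfy the relations in \<open>cyclotomic_arith\<close> with
  \<open>m = p - 1\<close>.\<close>

lemma pair_count_pos:
  fixes p :: nat
  assumes p: "prime p" and p3: "p mod 3 = 1" and p16: "p > 16"
    and abt: "\<not> int p dvd a" "\<not> int p dvd b" "\<not> int p dvd t"
  shows "pair_count p a b t \<noteq> 0"
proof -
  let ?p = "int p"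
  let ?R = "pair_count ?p"
  have pp: "prime ?p"
    using p by simp
  obtain g where g: "\<not> ?p dvd g"
    and repr: "\<And>t. \<not> ?p dvd t \<Longrightarrow> \<exists>s k. \<not> ?p dvd s \<and> k < (3::nat) \<and> [t = g ^ k * s ^ 3] (mod ?p)"
    and ncube: "\<And>u v. \<not> ?p dvd u \<Longrightarrow> \<not> ?p dvd u ^ 3 + g * v ^ 3"
    using cubic_class_representatives[OF p p3] by blast
  have g2: "\<not> ?p dvd g ^ 2"
    using pp g by (simp add: prime_dvd_power_iff)
  note class_sum = sum_units_class_function[OF pp g]
  note cube = pair_count_cube[OF pp] pair_count_cube'[OF pp]
  note scale = pair_count_scale[OF pp]
  \<comment> \<open>\<open>- 1\<close> is a cube.\<close>
  have neg: "?R a b (- t) = ?R a b t" for a b t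
    using cube(3)[of "- 1" a b t] prime_gt_1_int[OF pp] by simp
  define m where "m = ?p - 1"
  have m: "m > 15"
    using p16 by (simp add: m_def)
  \<comment> \<open>These represent the exponent triples modulo 3 under permutation and simultaneous
    translation: \<open>(0, 0, 0)\<close>, \<open>(0, 0, 1)\<close>, \<open>(0, 0, 2)\<close> and
    \<open>(0, 1, 2)\<close>. The equations that follow bring other triples to these forms.\<close>
  define \<alpha> \<beta> \<gamma> \<delta> where "\<alpha> = ?R 1 1 1" and "\<beta> = ?R 1 1 g" and "\<gamma> = ?R 1 1 (g ^ 2)" and "\<delta> = ?R 1 g (g ^ 2)"
  note defs = \<alpha>_def \<beta>_def \<gamma>_def \<delta>_def
  have g3: "?R (g ^ 3) b t = ?R 1 b t" "?R a (g ^ 3) t = ?R a 1 t" "?R a b (g ^ 3) = ?R a b 1" for a b t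
    using cube(1)[OF g, of 1] cube(2)[OF g, of _ 1] cube(3)[OF g, of _ _ 1] by simp_all
  have R1g1: "?R 1 g 1 = \<beta>"
    unfolding defs by (metis pair_count_commute pair_count_rotate[OF pp])
  have R1gg: "?R 1 g g = \<gamma>"
  proof -
    have "?R 1 g g = ?R (g ^ 2) (g ^ 3) (g ^ 3)"
      using scale[OF g2, of 1 g g] by (simp add: power2_eq_square power3_eq_cube mult.assoc)
    also have "\<dots> = ?R 1 1 (g ^ 2)"
      using g3 pair_count_rotate[OF pp, of "g ^ 2" 1 1] by simp
    finally show ?thesis
      by (simp add: defs)
  qed
  have Rggg: "?R g g g = \<alpha>" "?R g g (g ^ 2) = \<beta>" "?R g g 1 = \<gamma>"
    using scale[OF g, of 1 1 1] scale[OF g, of 1 1 g] R1gg pair_count_rotate[OF pp, of g g 1]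
    by (simp_all add: defs power2_eq_square)
  have R1gg2: "?R 1 (g ^ 2) g = \<delta>"
    unfolding defs by (metis pair_count_commute pair_count_rotate[OF pp])
  have R1g2g2: "?R 1 (g ^ 2) (g ^ 2) = \<beta>" "?R 1 (g ^ 2) 1 = \<gamma>"
  proof -
    have "?R 1 (g ^ 2) (g ^ 2) = ?R g (g ^ 3) (g ^ 3)"
      using scale[OF g, of 1 "g ^ 2" "g ^ 2"] by (simp flip: power_Suc)
    then show "?R 1 (g ^ 2) (g ^ 2) = \<beta>"
      using g3 pair_count_rotate[OF pp, of g 1 1] by (simp add: defs)
    show "?R 1 (g ^ 2) 1 = \<gamma>"
      unfolding defs by (metis pair_count_commute pair_count_rotate[OF pp])
  qed

  \<comment> \<open>A solution would make \<open>g\<close> a cube. For \<open>g ^ 2\<close>,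
    multiplying the equation by \<open>g\<close> turns \<open>g ^ 3 * v ^ 3\<close> into the cube of
    \<open>g * v\<close>.\<close>
  have R1g0: "?R 1 g 0 = 0"
    unfolding pair_count_def using ncube[OF range_not_dvd] by (intro sum.neutral ballI) simp
  have R1g20: "?R 1 (g ^ 2) 0 = 0"
    unfolding pair_count_def
  proof (intro sum.neutral ballI)
    fix u v assume u: "u \<in> {1..<?p}" and v: "v \<in> {1..<?p}"
    have "\<not> ?p dvd (g * v) ^ 3 + g * u ^ 3"
      using ncube[of "g * v" u] g pp range_not_dvd[OF v] by (simp add: prime_dvd_mult_iff)
    moreover have "(g * v) ^ 3 + g * u ^ 3 = g * (1 * u ^ 3 + g ^ 2 * v ^ 3 + 0)"
      by (simp add: algebra_simps power_mult_distrib power2_eq_square power3_eq_cube)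
    ultimately have "\<not> ?p dvd 1 * u ^ 3 + g ^ 2 * v ^ 3 + 0"
      by (metis dvd_mult)
    then show "of_bool (?p dvd 1 * u ^ 3 + g ^ 2 * v ^ 3 + 0) = (0 :: int)"
      by simp
  qed
  \<comment> \<open>Summed over all units \<open>t\<close>, the equations
    \<open>u ^ 3 + t * v ^ 3 = 0\<close> have \<open>m ^ 2\<close> solutions; only the class of
    \<open>t = 1\<close> contributes.\<close>
  have R110: "?R 1 1 0 = 3 * m"
  proof -
    have "(\<Sum>t\<in>{1..<?p}. ?R 1 t 0) = (\<Sum>t\<in>{1..<?p}. ?R 0 1 t)"
      by (intro sum.cong refl) (metis pair_count_commute pair_count_rotate[OF pp])
    also have "\<dots> = m ^ 2 - ?R 0 1 0"
      unfolding m_def by (rule sum_pair_count[OF pp])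
    also have "?R 0 1 0 = 0"
      unfolding pair_count_def using pp range_not_dvd[of _ ?p]
      by (intro sum.neutral ballI) (simp add: prime_dvd_power_iff)
    finally have "(\<Sum>t\<in>{1..<?p}. ?R 1 t 0) = m ^ 2"
      by simp
    moreover have "3 * (\<Sum>t\<in>{1..<?p}. ?R 1 t 0) = m * (?R 1 1 0 + ?R 1 g 0 + ?R 1 (g ^ 2) 0)"
      unfolding m_def
      by (rule class_sum[where F = "\<lambda>t. ?R 1 t 0"], erule repr, rule pair_count_cong[OF cong_refl _ cong_refl])
         (simp_all add: cube)
    ultimately show ?thesis
      using R1g0 R1g20 m by (simp add: power2_eq_square)
  qed

  \<comment> \<open>The two linear relations come from summing over \<open>t\<close> with leading
    coefficients \<open>(1, 1)\<close> and then \<open>(1, g)\<close>.\<close>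
  have "3 * (\<Sum>t\<in>{1..<?p}. ?R 1 1 t) = m * (\<alpha> + \<beta> + \<gamma>)"
    unfolding m_def defs
    by (rule class_sum[where F = "\<lambda>t. ?R 1 1 t"], erule repr, rule pair_count_cong[OF cong_refl cong_refl])
       (simp_all add: cube)
  then have "3 * (m ^ 2 - 3 * m) = m * (\<alpha> + \<beta> + \<gamma>)"
    using sum_pair_count[OF pp, of 1 1] R110 by (simp add: m_def)
  then have "m * (3 * m - 9) = m * (\<alpha> + \<beta> + \<gamma>)"
    by (simp add: power2_eq_square algebra_simps)
  then have sum1: "\<alpha> + \<beta> + \<gamma> = 3 * m - 9"
    using m by simp
  have "3 * (\<Sum>t\<in>{1..<?p}. ?R 1 g t) = m * (?R 1 g 1 + ?R 1 g g + ?R 1 g (g ^ 2))"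
    unfolding m_def
    by (rule class_sum[where F = "\<lambda>t. ?R 1 g t"], erule repr, rule pair_count_cong[OF cong_refl cong_refl])
       (simp_all add: cube)
  then have "3 * m ^ 2 = m * (?R 1 g 1 + ?R 1 g g + ?R 1 g (g ^ 2))"
    using sum_pair_count[OF pp, of 1 g] R1g0 by (simp add: m_def)
  then have sum2: "\<beta> + \<gamma> + \<delta> = 3 * m"
    using m R1g1 R1gg by (simp add: power2_eq_square defs)
  have split0: "(\<Sum>t\<in>{0..<?p}. F t) = F 0 + (\<Sum>t\<in>{1..<?p}. F t)" for F :: "int \<Rightarrow> int"
  proof -
    have "{0..<?p} = insert 0 {1..<?p}"
      using p16 by auto
    then show ?thesis
      by simp
  qed
  \<comment> \<open>First pairing, \<open>(1, 1)\<close> with \<open>(g, g)\<close>: the term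
    \<open>t = 0\<close> contributes \<open>27 * m ^ 2\<close> to the tripled sum. In the second
    pairing, \<open>(1, g)\<close> with \<open>(1, g)\<close>, that term vanishes.\<close>
  have "3 * (\<Sum>t\<in>{0..<?p}. ?R 1 1 t * ?R g g (- t)) =
      3 * (3 * m * ?R g g 0) + m * (\<alpha> * \<gamma> + \<beta> * \<alpha> + \<gamma> * \<beta>)"
  proof -
    have "3 * (\<Sum>t\<in>{1..<?p}. ?R 1 1 t * ?R g g t) =
        m * (?R 1 1 1 * ?R g g 1 + ?R 1 1 g * ?R g g g + ?R 1 1 (g ^ 2) * ?R g g (g ^ 2))"
      unfolding m_def
      by (rule class_sum[where F = "\<lambda>t. ?R 1 1 t * ?R g g t"], erule repr,
          rule arg_cong2[where f = times]; (rule pair_count_cong[OF cong_refl cong_refl])?)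
         (simp_all add: cube)
    also have "\<dots> = m * (\<alpha> * \<gamma> + \<beta> * \<alpha> + \<gamma> * \<beta>)"
      unfolding Rggg by (simp add: defs)
    finally have "3 * (\<Sum>t\<in>{1..<?p}. ?R 1 1 t * ?R g g t) = m * (\<alpha> * \<gamma> + \<beta> * \<alpha> + \<gamma> * \<beta>)" .
    then show ?thesis
      by (simp add: split0 neg R110)
  qed
  moreover have "?R g g 0 = 3 * m"
    using scale[OF g, of 1 1 0] R110 by simp
  moreover have "3 * (\<Sum>t\<in>{0..<?p}. ?R 1 g t * ?R 1 g (- t)) = m * (\<beta> ^ 2 + \<gamma> ^ 2 + \<delta> ^ 2)"
  proof -
    have "3 * (\<Sum>t\<in>{1..<?p}. ?R 1 g t * ?R 1 g t) =
        m * (?R 1 g 1 * ?R 1 g 1 + ?R 1 g g * ?R 1 g g + ?R 1 g (g ^ 2) * ?R 1 g (g ^ 2))"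
      unfolding m_def
      by (rule class_sum[where F = "\<lambda>t. ?R 1 g t * ?R 1 g t"], erule repr,
          rule arg_cong2[where f = times]; (rule pair_count_cong[OF cong_refl cong_refl])?)
         (simp_all add: cube)
    then have "3 * (\<Sum>t\<in>{1..<?p}. ?R 1 g t * ?R 1 g t) = m * (\<beta> * \<beta> + \<gamma> * \<gamma> + \<delta> * \<delta>)"
      unfolding R1g1 R1gg \<delta>_def .
    then show ?thesis
      by (simp add: split0 neg R1g0 power2_eq_square)
  qed
  ultimately have "m * (27 * m + \<alpha> * \<gamma> + \<beta> * \<alpha> + \<gamma> * \<beta>) = m * (\<beta> ^ 2 + \<gamma> ^ 2 + \<delta> ^ 2)"
    using sum_pair_count_mult[OF pp, of 1 1 g g] by (simp add: algebra_simps)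
  then have quad: "27 * m + \<alpha> * \<gamma> + \<beta> * \<alpha> + \<gamma> * \<beta> = \<beta> ^ 2 + \<gamma> ^ 2 + \<delta> ^ 2"
    using m by simp
  have nonneg: "\<alpha> \<ge> 0" "\<beta> \<ge> 0" "\<gamma> \<ge> 0"
    unfolding defs by (rule pair_count_nonneg)+
  note nz = cyclotomic_arith[OF nonneg sum1 sum2 quad m]

  \<comment> \<open>Dividing by \<open>a\<close> and replacing the other two coefficients by class
    representatives leaves nine pairs of exponents, each giving one of the four counts.\<close>
  obtain a' where a': "[a * a' = 1] (mod ?p)" "\<not> ?p dvd a'"
    using unit_inverse[OF pp abt(1)] .
  have "\<not> ?p dvd a' * b" "\<not> ?p dvd a' * t"
    using a' abt pp by (simp_all add: prime_dvd_mult_iff)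
  then obtain s k s' k' where s: "\<not> ?p dvd s" "k < (3::nat)" "[a' * b = g ^ k * s ^ 3] (mod ?p)"
    and s': "\<not> ?p dvd s'" "k' < (3::nat)" "[a' * t = g ^ k' * s' ^ 3] (mod ?p)"
    using repr by meson
  have "?R a b t = ?R (a' * a) (a' * b) (a' * t)"
    using scale[OF a'(2)] by simp
  also have "\<dots> = ?R 1 (g ^ k * s ^ 3) (g ^ k' * s' ^ 3)"
    using a'(1) s(3) s'(3) by (intro pair_count_cong) (simp_all add: mult.commute)
  also have "\<dots> = ?R 1 (g ^ k) (g ^ k')"
    using cube s(1) s'(1) by simp
  finally have "?R a b t = ?R 1 (g ^ k) (g ^ k')" .
  moreover have "k \<in> {0, 1, 2}" "k' \<in> {0, 1, 2}"
    using s(2) s'(2) by auto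
  moreover note nz R1g1 R1gg R1gg2 R1g2g2
  ultimately show ?thesis
    by (auto simp: defs)
qed

lemma cube_pair_representation_1_mod_3:
  fixes p :: nat
  assumes "prime p" "p mod 3 = 1" "p > 16"
    and "\<not> int p dvd a" "\<not> int p dvd b" "\<not> int p dvd t"
  obtains u v where "\<not> int p dvd u" "\<not> int p dvd v" "[u ^ 3 * a + v ^ 3 * b = t] (mod int p)"
proof -
  have "pair_count p a b (- t) \<noteq> 0"
    using assms by (intro pair_count_pos) auto
  then obtain u v where "u \<in> {1..<int p}" "v \<in> {1..<int p}" "int p dvd a * u ^ 3 + b * v ^ 3 + - t"
    by (rule pair_count_nonzeroD)
  then show thesis
    by (intro that[of u v] range_not_dvd) (auto simp: cong_iff_dvd_diff mult.commute)
qed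

section \<open>Cube-weighted zero-sums modulo primes\<close>

text \<open>An indexed family lets equal terms carry different weights. Quantifying over the cube
  roots \<open>u i\<close> rather than the cubes lets the Chinese remainder theorem act on them
  directly.\<close>

definition cube_zero_sum :: "int \<Rightarrow> 'a set \<Rightarrow> ('a \<Rightarrow> int) \<Rightarrow> bool" where
  "cube_zero_sum m I x \<longleftrightarrow> (\<exists>u. (\<forall>i\<in>I. coprime (u i) m) \<and> m dvd (\<Sum>i\<in>I. u i ^ 3 * x i))"

text \<open>One less than the number of nonzero terms that forces a cube-weighted zero-sum modulo \<open>p\<close>.\<close>

definition cube_weight :: "nat \<Rightarrow> nat" where
  "cube_weight p = (if p mod 3 = 1 then 2 else 1)"

section \<open>Cancelling with two or three nonzero terms modulo one prime\<close>

text \<open>The exponent \<open>2 * k + 1\<close> inverts 3 modulo \<open>p - 1\<close>, because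
  \<open>3 * (2 * k + 1) = 2 * (p - 1) + 1\<close>; so \<open>d ^ (2 * k + 1)\<close> is a cube root
  of \<open>d\<close>.\<close>

lemma unit_is_cube_2_mod_3:
  fixes p :: nat
  assumes p: "prime p" and p3: "p mod 3 = 2" and d: "\<not> int p dvd d"
  obtains s where "\<not> int p dvd s" "[s ^ 3 = d] (mod int p)"
proof -
  define k where "k = (p - 2) div 3"
  have k: "p - 1 = 3 * k + 1"
    using p3 prime_ge_2_nat[OF p] unfolding k_def by presburger
  have "[d * (d ^ (p - 1)) ^ 2 = d * 1 ^ 2] (mod int p)"
    by (intro cong_mult cong_pow cong_refl fermat_int p d)
  moreover have "(d ^ (2 * k + 1)) ^ 3 = d * (d ^ (p - 1)) ^ 2"
  proof -
    have "(d ^ (2 * k + 1)) ^ 3 = d ^ (1 + (p - 1) * 2)"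
      unfolding k power_mult[symmetric] by (rule arg_cong[where f = "power d"]) simp
    then show ?thesis
      by (simp only: power_add power_mult power_one_right)
  qed
  ultimately have "[(d ^ (2 * k + 1)) ^ 3 = d] (mod int p)"
    by simp
  moreover have "\<not> int p dvd d ^ (2 * k + 1)"
    using prime_dvd_power[of "int p" d "2 * k + 1"] p d by auto
  ultimately show thesis
    using that by blast
qed

text \<open>One of \<open>1\<close> and \<open>2\<close> works: if both failed, \<open>p\<close>
  would divide \<open>(2 ^ 3 - 1 ^ 3) * a = 7 * a\<close>.\<close>

lemma unit_cube_avoid:
  fixes p :: nat
  assumes p: "prime p" and "odd p" "p \<noteq> 7" and a: "\<not> int p dvd a"
  obtains w where "\<not> int p dvd w" "\<not> int p dvd t - w ^ 3 * a"
proof (cases "int p dvd t - 1 ^ 3 * a")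
  case False
  then show thesis
    using that[of 1] prime_gt_1_nat[OF p] by simp
next
  case True
  have prime7: "prime (7 :: nat)"
    by simp
  have "\<not> int p dvd 7"
    using assms primes_dvd_imp_eq[OF p prime7] by (metis int_dvd_int_iff of_nat_numeral)
  then have "\<not> int p dvd 7 * a"
    using p a by (simp add: prime_dvd_mult_iff)
  moreover have "7 * a = (t - 1 ^ 3 * a) - (t - 2 ^ 3 * a)"
    by simp
  ultimately have "\<not> int p dvd t - 2 ^ 3 * a"
    using True by (metis dvd_diff)
  moreover have "\<not> int p dvd 2"
    using \<open>odd p\<close> primes_dvd_imp_eq[OF p two_is_prime_nat] by (metis even_numeral int_dvd_int_iff of_nat_numeral)
  ultimately show thesis
    using that by blast
qed

text \<open>Once \<open>u\<close> is chosen so that \<open>t - u ^ 3 * a\<close> is a unit, its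
  quotient by \<open>b\<close> is a cube. Here \<open>t\<close> may be 0 modulo \<open>p\<close>,
  whereas for \<open>p mod 3 = 1\<close> only units are represented.\<close>

lemma cube_pair_representation_2_mod_3:
  fixes p :: nat
  assumes p: "prime p" and p3: "p mod 3 = 2" and "odd p"
    and a: "\<not> int p dvd a" and b: "\<not> int p dvd b"
  obtains u v where "\<not> int p dvd u" "\<not> int p dvd v" "[u ^ 3 * a + v ^ 3 * b = t] (mod int p)"
proof -
  have "p \<noteq> 7"
    using p3 by auto
  then obtain u where u: "\<not> int p dvd u" "\<not> int p dvd t - u ^ 3 * a"
    using unit_cube_avoid[OF p \<open>odd p\<close> _ a] by blast
  obtain b' where b': "[b * b' = 1] (mod int p)" "\<not> int p dvd b'"
    using unit_inverse[of "int p" b] p b by auto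
  have "\<not> int p dvd b' * (t - u ^ 3 * a)"
    using u b' p by (simp add: prime_dvd_mult_iff)
  then obtain v where v: "\<not> int p dvd v" "[v ^ 3 = b' * (t - u ^ 3 * a)] (mod int p)"
    using unit_is_cube_2_mod_3[OF p p3] by blast
  have "[v ^ 3 * b = b' * (t - u ^ 3 * a) * b] (mod int p)"
    by (intro cong_mult v cong_refl)
  also have "b' * (t - u ^ 3 * a) * b = (b * b') * (t - u ^ 3 * a)"
    by simp
  also have "[\<dots> = 1 * (t - u ^ 3 * a)] (mod int p)"
    by (intro cong_mult b' cong_refl)
  finally have "[u ^ 3 * a + v ^ 3 * b = u ^ 3 * a + (t - u ^ 3 * a)] (mod int p)"
    by (intro cong_add cong_refl) simp
  then show thesis
    using u v that by simp
qed

text \<open>All terms get weight 1 except two or three nonzero ones, which cancel the rest of the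
  sum.\<close>

lemma cube_zero_sum_prime:
  fixes p :: nat and x :: "'a \<Rightarrow> int"
  assumes p: "prime p" and "odd p" "p mod 3 \<noteq> 0" "p \<noteq> 7" "p \<noteq> 13" and I: "finite I"
    and N: "{i \<in> I. \<not> int p dvd x i} = {} \<or> card {i \<in> I. \<not> int p dvd x i} > cube_weight p"
  shows "cube_zero_sum (int p) I x"
proof -
  let ?N = "{i \<in> I. \<not> int p dvd x i}"
  have cop: "coprime u (int p) \<longleftrightarrow> \<not> int p dvd u" for u
    using p prime_imp_coprime[of "int p" u] coprime_absorb_left[of "int p" u]
    by (auto simp: coprime_commute)
  consider "?N = {}" | "p mod 3 = 1" "card ?N \<ge> 3" | "p mod 3 = 2" "card ?N \<ge> 2"
    using N \<open>p mod 3 \<noteq> 0\<close> by (fastforce simp: cube_weight_def split: if_splits)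
  then show ?thesis
  proof cases
    case 1
    then have "int p dvd (\<Sum>i\<in>I. 1 ^ 3 * x i)"
      by (intro dvd_sum) auto
    then show ?thesis
      unfolding cube_zero_sum_def by (intro exI[of _ "\<lambda>_. 1"]) simp
  next
    case 2
    \<comment> \<open>The only primes up to 16 that are congruent to 1 modulo 3 are 7 and
      13.\<close>
    have "p > 16"
      using 2(1) \<open>odd p\<close> \<open>p \<noteq> 7\<close> \<open>p \<noteq> 13\<close> prime_gt_1_nat[OF p] by presburger
    obtain M where "M \<subseteq> ?N" "card M = 3"
      using obtain_subset_with_card_n[OF 2(2)] by blast
    then obtain i j l where ijl: "i \<in> ?N" "j \<in> ?N" "l \<in> ?N" "i \<noteq> j" "j \<noteq> l" "i \<noteq> l"
      by (auto simp: card_3_iff)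
    define I' where "I' = I - {i, j, l}"
    have I': "I = insert i (insert j (insert l I'))" "i \<notin> I'" "j \<notin> I'" "l \<notin> I'" "finite I'"
      using ijl I by (auto simp: I'_def)
    \<comment> \<open>The third term turns the target into a unit, as the representation by two
      terms requires.\<close>
    obtain w where w: "\<not> int p dvd w" "\<not> int p dvd - (\<Sum>k\<in>I'. x k) - w ^ 3 * x l"
      using unit_cube_avoid[OF p \<open>odd p\<close> \<open>p \<noteq> 7\<close>, of "x l"] ijl(3) by blast
    obtain u v where uv: "\<not> int p dvd u" "\<not> int p dvd v"
      "[u ^ 3 * x i + v ^ 3 * x j = - (\<Sum>k\<in>I'. x k) - w ^ 3 * x l] (mod int p)"
      using cube_pair_representation_1_mod_3[OF p 2(1) \<open>p > 16\<close> _ _ w(2), of "x i" "x j"] ijl by blast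
    define c where "c = (\<lambda>k. 1 :: int)(i := u, j := v, l := w)"
    have "(\<Sum>k\<in>I'. c k ^ 3 * x k) = (\<Sum>k\<in>I'. x k)"
      using I' by (intro sum.cong) (auto simp: c_def)
    then have "(\<Sum>k\<in>I. c k ^ 3 * x k) = u ^ 3 * x i + v ^ 3 * x j - (- (\<Sum>k\<in>I'. x k) - w ^ 3 * x l)"
      unfolding I'(1) using I' ijl by (simp add: c_def)
    then have "int p dvd (\<Sum>k\<in>I. c k ^ 3 * x k)"
      using uv(3) unfolding cong_iff_dvd_diff by (simp only:)
    moreover have "\<forall>k\<in>I. coprime (c k) (int p)"
      using uv w p by (auto simp: c_def cop)
    ultimately show ?thesis
      unfolding cube_zero_sum_def by blast
  next
    case 3
    obtain M where "M \<subseteq> ?N" "card M = 2"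
      using obtain_subset_with_card_n[OF 3(2)] by blast
    then obtain i j where ij: "i \<in> ?N" "j \<in> ?N" "i \<noteq> j"
      by (auto simp: card_2_iff)
    define I' where "I' = I - {i, j}"
    have I': "I = insert i (insert j I')" "i \<notin> I'" "j \<notin> I'" "finite I'"
      using ij I by (auto simp: I'_def)
    obtain u v where uv: "\<not> int p dvd u" "\<not> int p dvd v"
      "[u ^ 3 * x i + v ^ 3 * x j = - (\<Sum>k\<in>I'. x k)] (mod int p)"
      using cube_pair_representation_2_mod_3[OF p 3(1) \<open>odd p\<close>, of "x i" "x j"] ij by blast
    define c where "c = (\<lambda>k. 1 :: int)(i := u, j := v)"
    have "(\<Sum>k\<in>I'. c k ^ 3 * x k) = (\<Sum>k\<in>I'. x k)"
      using I' by (intro sum.cong) (auto simp: c_def)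
    then have "(\<Sum>k\<in>I. c k ^ 3 * x k) = u ^ 3 * x i + v ^ 3 * x j - (- (\<Sum>k\<in>I'. x k))"
      unfolding I'(1) using I' ij by (simp add: c_def)
    then have "int p dvd (\<Sum>k\<in>I. c k ^ 3 * x k)"
      using uv(3) unfolding cong_iff_dvd_diff by (simp only:)
    moreover have "\<forall>k\<in>I. coprime (c k) (int p)"
      using uv p by (auto simp: c_def cop)
    ultimately show ?thesis
      unfolding cube_zero_sum_def by blast
  qed
qed

section \<open>Gluing the primes and selecting terms\<close>

text \<open>The Chinese remainder theorem glues the cube roots, and with them the weights, term by
  term.\<close>

lemma cube_zero_sum_mult:
  assumes cop: "coprime m1 m2" and "cube_zero_sum m1 I x" "cube_zero_sum m2 I x"
  shows "cube_zero_sum (m1 * m2) I x"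
proof -
  obtain u1 where u1: "\<forall>i\<in>I. coprime (u1 i) m1" "m1 dvd (\<Sum>i\<in>I. u1 i ^ 3 * x i)"
    using assms(2) unfolding cube_zero_sum_def by blast
  obtain u2 where u2: "\<forall>i\<in>I. coprime (u2 i) m2" "m2 dvd (\<Sum>i\<in>I. u2 i ^ 3 * x i)"
    using assms(3) unfolding cube_zero_sum_def by blast
  have "\<forall>i. \<exists>c. [c = u1 i] (mod m1) \<and> [c = u2 i] (mod m2)"
    using binary_chinese_remainder_int[OF cop] by blast
  then obtain u where u: "[u i = u1 i] (mod m1)" "[u i = u2 i] (mod m2)" for i
    by (metis (no_types))
  have "coprime (u i) (m1 * m2)" if "i \<in> I" for i
    using u1(1) u2(1) u[of i] that by (metis cong_imp_coprime cong_sym coprime_mult_right_iff)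
  moreover have "[(\<Sum>i\<in>I. u i ^ 3 * x i) = (\<Sum>i\<in>I. u1 i ^ 3 * x i)] (mod m1)"
    "[(\<Sum>i\<in>I. u i ^ 3 * x i) = (\<Sum>i\<in>I. u2 i ^ 3 * x i)] (mod m2)"
    by (intro cong_sum cong_mult cong_pow u cong_refl)+
  then have "m1 * m2 dvd (\<Sum>i\<in>I. u i ^ 3 * x i)"
    using u1(2) u2(2) cop by (simp add: cong_dvd_iff divides_mult)
  ultimately show ?thesis
    unfolding cube_zero_sum_def by blast
qed

lemma cube_zero_sum_prod_primes:
  assumes "finite P" "\<And>p. p \<in> P \<Longrightarrow> prime (p :: nat)" "\<And>p. p \<in> P \<Longrightarrow> cube_zero_sum (int p) I x"
  shows "cube_zero_sum (int (\<Prod>P)) I x"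
  using assms
proof (induction P rule: finite_induct)
  case empty
  then show ?case
    by (auto simp: cube_zero_sum_def)
next
  case (insert p P)
  have "coprime p (\<Prod>P)"
    using insert by (intro prod_coprime_right primes_coprime) auto
  then have "cube_zero_sum (int p * int (\<Prod>P)) I x"
    using insert by (intro cube_zero_sum_mult) (simp_all del: of_nat_prod)
  then show ?case
    using insert by simp
qed

text \<open>
  As long as some \<open>N p\<close> meets \<open>J\<close> in at most \<open>w p\<close> points, delete those points; afterwards keep
  \<open>w p + 1\<close> points of each surviving \<open>N p\<close>.
\<close>

lemma exists_subset_card_Int:
  fixes w :: "'b \<Rightarrow> nat"
  assumes "finite P" "finite J" "card J \<ge> m + (\<Sum>p\<in>P. w p)" "m \<ge> (\<Sum>p\<in>P. w p + 1)"
  shows "\<exists>I\<subseteq>J. card I = m \<and> (\<forall>p\<in>P. I \<inter> N p = {} \<or> card (I \<inter> N p) > w p)"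
  using assms
proof (induction "card P" arbitrary: P J)
  case 0
  then have "P = {}" "m \<le> card J"
    by simp_all
  then show ?case
    by (metis empty_iff obtain_subset_with_card_n)
next
  case (Suc k)
  show ?case
  proof (cases "\<forall>p\<in>P. card (J \<inter> N p) > w p")
    case True
    then have "\<forall>p\<in>P. \<exists>W\<subseteq>J \<inter> N p. card W = w p + 1"
      by (metis Suc_eq_plus1 Suc_leI obtain_subset_with_card_n)
    then obtain W where W: "\<And>p. p \<in> P \<Longrightarrow> W p \<subseteq> J \<inter> N p" "\<And>p. p \<in> P \<Longrightarrow> card (W p) = w p + 1"
      by metis
    \<comment> \<open>The chosen sets may overlap, but their union has at most \<open>m\<close>
      points and so extends to a subset of \<open>J\<close> of size \<open>m\<close>.\<close>
    have "card (\<Union>p\<in>P. W p) \<le> (\<Sum>p\<in>P. card (W p))"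
      by (rule card_UN_le[OF Suc.prems(1)])
    also have "\<dots> \<le> m"
      using W Suc.prems(4) by simp
    finally have "card (\<Union>p\<in>P. W p) \<le> m" .
    moreover have "(\<Union>p\<in>P. W p) \<subseteq> J" "m \<le> card J"
      using W Suc.prems(3) by auto
    ultimately obtain I where I: "(\<Union>p\<in>P. W p) \<subseteq> I" "I \<subseteq> J" "card I = m"
      using exists_subset_between[OF _ _ _ Suc.prems(2)] by blast
    have "card (I \<inter> N p) > w p" if p: "p \<in> P" for p
    proof -
      have "finite I"
        using I Suc.prems(2) finite_subset by blast
      then have "card (W p) \<le> card (I \<inter> N p)"
        using I W(1)[OF p] p by (intro card_mono) auto
      then show ?thesis
        using W(2)[OF p] by simp
    qed
    then show ?thesis
      using I by blast
  next
    case False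
    then obtain p where p: "p \<in> P" "card (J \<inter> N p) \<le> w p"
      by fastforce
    have sums: "(\<Sum>q\<in>P. f q) = f p + (\<Sum>q\<in>P - {p}. f q)" for f :: "'b \<Rightarrow> nat"
      using p Suc.prems(1) by (simp add: sum.remove)
    \<comment> \<open>Deleting \<open>N p\<close> costs at most \<open>w p\<close> points, just what
      dropping \<open>p\<close> releases from the bound; subsets of \<open>J - N p\<close> stay
      disjoint from \<open>N p\<close>.\<close>
    have "card (J - N p) = card J - card (J \<inter> N p)"
      using Suc.prems(2) by (simp add: card_Diff_subset_Int)
    then have "card (J - N p) \<ge> m + (\<Sum>q\<in>P - {p}. w q)"
      using Suc.prems(3) p sums[of w] by linarith
    moreover have "m \<ge> (\<Sum>q\<in>P - {p}. w q + 1)"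
      using Suc.prems(4) sums[of "\<lambda>q. w q + 1"] by linarith
    moreover have "k = card (P - {p})"
      using Suc.hyps(2) p Suc.prems(1) by (simp add: card_Diff_singleton)
    ultimately obtain I where "I \<subseteq> J - N p" "card I = m"
        "\<forall>q\<in>P - {p}. I \<inter> N q = {} \<or> card (I \<inter> N q) > w q"
      using Suc.hyps(1)[of "P - {p}" "J - N p"] Suc.prems(1,2) by auto
    then show ?thesis
      by (intro exI[of _ I]) blast
  qed
qed

section \<open>Weighted zero-sum sequences\<close>

text \<open>One multiset of weight-term pairs replaces two parallel lists, so filtering and mapping
  keep the weights attached.\<close>

lemma weighted_zero_sum_iff_pairs:
  "weighted_zero_sum n A S \<longleftrightarrow>
    (\<exists>Z. image_mset snd Z = S \<and> fst ` set_mset Z \<subseteq> A \<and> [(\<Sum>z\<in>#Z. fst z * snd z) = 0] (mod int n))"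
proof
  assume "weighted_zero_sum n A S"
  then obtain xs ws where *: "mset xs = S" "length ws = length xs" "set ws \<subseteq> A"
    "[(\<Sum>i<length xs. ws ! i * xs ! i) = 0] (mod int n)"
    unfolding weighted_zero_sum_def by blast
  let ?Z = "mset (zip ws xs)"
  have "(\<Sum>z\<in>#?Z. fst z * snd z) = sum_list (map (\<lambda>z. fst z * snd z) (zip ws xs))"
    by (metis mset_map sum_mset_sum_list)
  also have "\<dots> = (\<Sum>i<length xs. ws ! i * xs ! i)"
    using *(2) by (simp add: sum_list_sum_nth atLeast0LessThan)
  finally have "[(\<Sum>z\<in>#?Z. fst z * snd z) = 0] (mod int n)"
    using *(4) by simp
  moreover have "image_mset snd ?Z = S" "fst ` set_mset ?Z \<subseteq> A"
    using * by (auto simp flip: mset_map dest: set_zip_leftD)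
  ultimately show "\<exists>Z. image_mset snd Z = S \<and> fst ` set_mset Z \<subseteq> A \<and>
      [(\<Sum>z\<in>#Z. fst z * snd z) = 0] (mod int n)"
    by blast
next
  assume "\<exists>Z. image_mset snd Z = S \<and> fst ` set_mset Z \<subseteq> A \<and>
    [(\<Sum>z\<in>#Z. fst z * snd z) = 0] (mod int n)"
  then obtain Z where Z: "image_mset snd Z = S" "fst ` set_mset Z \<subseteq> A"
    "[(\<Sum>z\<in>#Z. fst z * snd z) = 0] (mod int n)"
    by blast
  obtain zs where zs: "mset zs = Z"
    using ex_mset by blast
  have "(\<Sum>i<length (map snd zs). map fst zs ! i * map snd zs ! i) = (\<Sum>z\<in>#Z. fst z * snd z)"
    unfolding zs[symmetric] mset_map[symmetric] sum_mset_sum_list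
    by (simp add: sum_list_sum_nth atLeast0LessThan)
  then show "weighted_zero_sum n A S"
    unfolding weighted_zero_sum_def using Z zs
    by - (rule exI[of _ "map snd zs"], rule exI[of _ "map fst zs"], auto simp: image_subset_iff)
qed

text \<open>Terms equal to 0 contribute nothing under any weight, so padding by zeros can be undone;
  the result may be empty.\<close>

lemma weighted_zero_sum_filter_nonzero:
  assumes "weighted_zero_sum n A S"
  shows "weighted_zero_sum n A (filter_mset (\<lambda>x. x \<noteq> 0) S)"
proof -
  obtain Z where Z: "image_mset snd Z = S" "fst ` set_mset Z \<subseteq> A"
    "[(\<Sum>z\<in>#Z. fst z * snd z) = 0] (mod int n)"
    using assms unfolding weighted_zero_sum_iff_pairs by blast
  let ?Z = "filter_mset (\<lambda>z. snd z \<noteq> 0) Z"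
  have "(\<Sum>z\<in>#?Z. fst z * snd z) = (\<Sum>z\<in>#Z. fst z * snd z)"
    by (induction Z) auto
  moreover have "image_mset snd ?Z = filter_mset (\<lambda>x. x \<noteq> 0) S"
    unfolding Z(1)[symmetric] by (induction Z) auto
  ultimately show ?thesis
    unfolding weighted_zero_sum_iff_pairs using Z by (intro exI[of _ ?Z]) auto
qed

lemma unit_cubes_memI:
  assumes "n > 0" "coprime u (int n)"
  shows "u ^ 3 mod int n \<in> unit_cubes n"
proof -
  have "u mod int n \<in> Zmod n" "coprime (u mod int n) (int n)"
    using assms by (auto simp: Zmod_def)
  then show ?thesis
    unfolding unit_cubes_def by (auto simp: power_mod intro!: exI[of _ "u mod int n"])
qed

lemma cube_zero_sum_imp_weighted_zero_sum:
  assumes "n > 0" "finite I" "cube_zero_sum (int n) I x"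
  shows "weighted_zero_sum n (unit_cubes n) (image_mset x (mset_set I))"
proof -
  obtain u where u: "\<forall>i\<in>I. coprime (u i) (int n)" "int n dvd (\<Sum>i\<in>I. u i ^ 3 * x i)"
    using assms(3) unfolding cube_zero_sum_def by blast
  let ?Z = "image_mset (\<lambda>i. (u i ^ 3 mod int n, x i)) (mset_set I)"
  have "(\<Sum>z\<in>#?Z. fst z * snd z) = (\<Sum>i\<in>I. (u i ^ 3 mod int n) * x i)"
    by (simp add: multiset.map_comp comp_def sum_unfold_sum_mset)
  also have "[\<dots> = (\<Sum>i\<in>I. u i ^ 3 * x i)] (mod int n)"
    by (intro cong_sum cong_mult cong_refl) simp
  also have "[(\<Sum>i\<in>I. u i ^ 3 * x i) = 0] (mod int n)"
    using u(2) by (simp add: cong_0_iff)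
  finally have "[(\<Sum>z\<in>#?Z. fst z * snd z) = 0] (mod int n)" .
  moreover have "image_mset snd ?Z = image_mset x (mset_set I)"
    by (simp add: multiset.map_comp comp_def)
  moreover have "fst ` set_mset ?Z \<subseteq> unit_cubes n"
    using u(1) assms unit_cubes_memI[OF assms(1)] by auto
  ultimately show ?thesis
    unfolding weighted_zero_sum_iff_pairs by blast
qed

section \<open>The upper bound: zero-sums of length \<open>n\<close>\<close>

text \<open>With \<open>g p = p\<close> and \<open>f p = cube_weight p + 1\<close>, this gives room
  among \<open>n\<close> terms for those to be kept for each prime. The summand 1 makes the product
  positive in the induction step.\<close>

lemma sum_le_prod_of_ge_4:
  fixes f g :: "'a \<Rightarrow> nat"
  assumes "finite P" "\<And>p. p \<in> P \<Longrightarrow> f p \<le> 3" "\<And>p. p \<in> P \<Longrightarrow> 4 \<le> g p"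
  shows "(\<Sum>p\<in>P. f p) + 1 \<le> (\<Prod>p\<in>P. g p)"
  using assms
proof (induction P rule: finite_induct)
  case empty
  then show ?case by simp
next
  case (insert p P)
  let ?G = "\<Prod>p\<in>P. g p"
  have IH: "(\<Sum>p\<in>P. f p) + 1 \<le> ?G" and "f p \<le> 3" "4 \<le> g p"
    using insert by auto
  then have "f p + (\<Sum>p\<in>P. f p) + 1 \<le> 4 * ?G"
    by linarith
  also have "\<dots> \<le> g p * ?G"
    using \<open>4 \<le> g p\<close> by (rule mult_right_mono) simp
  finally show ?case
    using insert by simp
qed

lemma squarefree_prime_factors:
  fixes n :: nat
  assumes "squarefree n"
  shows "\<Prod>(prime_factors n) = n" "prime_factorization n = mset_set (prime_factors n)"
proof -
  have n: "n \<noteq> 0"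
    using assms by (metis not_squarefree_0)
  have mult: "multiplicity p n = 1" if "p \<in> prime_factors n" for p
    using assms that squarefree_factorial_semiring'[OF n] by blast
  then show "\<Prod>(prime_factors n) = n"
    using prod_prime_factors[OF n] by simp
  show "prime_factorization n = mset_set (prime_factors n)"
  proof (rule multiset_eqI)
    fix p
    show "count (prime_factorization n) p = count (mset_set (prime_factors n)) p"
    proof (cases "p \<in> prime_factors n")
      case True
      then show ?thesis
        using mult[OF True] in_prime_factors_imp_prime[OF True] by (simp add: count_prime_factorization)
    next
      case False
      then show ?thesis
        by (simp add: not_in_iff)
    qed
  qed
qed

lemma Omega_squarefree:
  assumes "squarefree n"
  shows "Omega n = card (prime_factors n)"
  unfolding Omega_def using arg_cong[OF squarefree_prime_factors(2)[OF assms], of size]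
  by (simp only: size_mset_set)

lemma exists_cube_weighted_zero_sum_length_n:
  fixes n :: nat and S :: "int multiset"
  assumes sf: "squarefree n" and n: "odd n" "\<not> 3 dvd n" "\<not> 7 dvd n" "\<not> 13 dvd n"
    and size: "size S \<ge> n + (\<Sum>p\<in>prime_factors n. cube_weight p)"
  shows "\<exists>S'. S' \<subseteq># S \<and> size S' = n \<and> weighted_zero_sum n (unit_cubes n) S'"
proof -
  let ?P = "prime_factors n"
  have n0: "n > 0"
    using n(1) by (simp add: odd_pos)
  obtain ys where ys: "mset ys = S"
    using ex_mset by blast
  \<comment> \<open>Positions are selected rather than values, so repeated terms remain
    distinct.\<close>
  let ?J = "{..<length ys}"
  have S: "S = image_mset ((!) ys) (mset_set ?J)"
    using ys by (metis map_nth mset_map mset_upt atLeast0LessThan)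
  have P: "prime p" "odd p" "p mod 3 \<noteq> 0" "p \<noteq> 7" "p \<noteq> 13" "p \<ge> 4" if "p \<in> ?P" for p
  proof -
    have "prime p" "p dvd n"
      using that by auto
    then show "prime p" "odd p" "p \<noteq> 7" "p \<noteq> 13"
      using n dvd_trans by blast+
    have "\<not> 3 dvd p"
      using \<open>p dvd n\<close> n(2) dvd_trans by blast
    then show 3: "p mod 3 \<noteq> 0"
      by (simp add: dvd_eq_mod_eq_0)
    have "p \<noteq> 2" "p \<noteq> 3"
      using \<open>odd p\<close> 3 by auto
    then show "p \<ge> 4"
      using prime_ge_2_nat[OF \<open>prime p\<close>] by linarith
  qed
  have "(\<Sum>p\<in>?P. cube_weight p + 1) + 1 \<le> (\<Prod>p\<in>?P. p)"
    using P(6) by (intro sum_le_prod_of_ge_4) (auto simp: cube_weight_def)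
  then have "(\<Sum>p\<in>?P. cube_weight p + 1) \<le> n"
    using squarefree_prime_factors(1)[OF sf] by simp
  moreover have "card ?J \<ge> n + (\<Sum>p\<in>?P. cube_weight p)"
    using size ys by auto
  ultimately obtain I where I: "I \<subseteq> ?J" "card I = n"
    "\<And>p. p \<in> ?P \<Longrightarrow> I \<inter> {i. \<not> int p dvd ys ! i} = {} \<or> card (I \<inter> {i. \<not> int p dvd ys ! i}) > cube_weight p"
    using exists_subset_card_Int[of ?P ?J n cube_weight "\<lambda>p. {i. \<not> int p dvd ys ! i}"] by auto
  have fin: "finite I"
    using I(1) finite_subset by blast
  have "cube_zero_sum (int p) I ((!) ys)" if p: "p \<in> ?P" for p
    using P[OF p] fin I(3)[OF p] by (intro cube_zero_sum_prime) (auto simp: Int_def)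
  then have "cube_zero_sum (int (\<Prod>?P)) I ((!) ys)"
    using P(1) by (intro cube_zero_sum_prod_primes) auto
  then have "cube_zero_sum (int n) I ((!) ys)"
    by (simp only: squarefree_prime_factors(1)[OF sf])
  then have "weighted_zero_sum n (unit_cubes n) (image_mset ((!) ys) (mset_set I))"
    by (rule cube_zero_sum_imp_weighted_zero_sum[OF n0 fin])
  moreover have "image_mset ((!) ys) (mset_set I) \<subseteq># S"
    unfolding S using I(1) fin by (intro image_mset_subseteq_mono) (simp add: msubset_mset_set_iff)
  ultimately show ?thesis
    using I(2) by (intro exI[of _ "image_mset ((!) ys) (mset_set I)"]) simp
qed

section \<open>The lower bound: sequences whose only zero-sums consist of zeros\<close>

lemma dvd_sum_mset:
  fixes f :: "'a \<Rightarrow> 'b :: comm_semiring_1"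
  assumes "\<And>z. z \<in># Z \<Longrightarrow> d dvd f z"
  shows "d dvd (\<Sum>z\<in>#Z. f z)"
  using assms by (induction Z) auto

lemma unit_cubes_memE:
  assumes "w \<in> unit_cubes n" "prime p" "p dvd n"
  obtains u where "\<not> int p dvd u" "[w = u ^ 3] (mod int p)"
proof -
  obtain u where u: "w = u ^ 3 mod int n" "coprime u (int n)"
    using assms(1) by (auto simp: unit_cubes_def)
  have "\<not> int p dvd u"
  proof
    assume "int p dvd u"
    moreover have "int p dvd int n"
      using assms(3) by simp
    ultimately have "is_unit (int p)"
      using u(2) by (meson coprime_common_divisor)
    then show False
      using assms(2) by simp
  qed
  moreover have "[w = u ^ 3] (mod int p)"
    using assms(3) by (simp add: u(1) cong_def mod_mod_cancel)
  ultimately show thesis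
    using that by blast
qed

text \<open>
  Modulo \<open>p\<close> only the terms built from \<open>n / p\<close> survive: one of them, or two whose quotient is not a
  cube.
\<close>

lemma exists_cube_weighted_zero_sum_free_set:
  fixes n :: nat
  assumes sf: "squarefree n"
  obtains X where "X \<subseteq> Zmod n" "0 \<notin> X" "card X = (\<Sum>p\<in>prime_factors n. cube_weight p)"
    "\<And>k S'. S' \<subseteq># mset_set X + replicate_mset k 0 \<Longrightarrow> weighted_zero_sum n (unit_cubes n) S' \<Longrightarrow>
      set_mset S' \<subseteq> {0}"
proof -
  let ?P = "prime_factors n"
  have n0: "n > 0"
    using sf by (metis gr0I not_squarefree_0)
  \<comment> \<open>For \<open>p mod 3 = 1\<close> this provides a non-cube; otherwise 1 is a
    placeholder.\<close>
  have "\<exists>g. \<not> int p dvd g \<and> (p mod 3 = 1 \<longrightarrow> (\<forall>u v. \<not> int p dvd u \<longrightarrow> \<not> int p dvd u ^ 3 + g * v ^ 3))"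
    if "p \<in> ?P" for p
  proof (cases "p mod 3 = 1")
    case True
    then show ?thesis
      using cubic_class_representatives[of p] that by (metis in_prime_factors_imp_prime)
  next
    case False
    then show ?thesis
      using in_prime_factors_imp_prime[OF that] by (intro exI[of _ 1]) auto
  qed
  then obtain g where g: "\<And>p. p \<in> ?P \<Longrightarrow> \<not> int p dvd g p"
    "\<And>p u v. p \<in> ?P \<Longrightarrow> p mod 3 = 1 \<Longrightarrow> \<not> int p dvd u \<Longrightarrow> \<not> int p dvd u ^ 3 + g p * v ^ 3"
    by metis
  \<comment> \<open>\<open>M p\<close> is a unit modulo \<open>p\<close> and 0 modulo every other
    prime factor of \<open>n\<close>; \<open>M' p\<close> is its multiple by \<open>g p\<close>,
    reduced so as to lie in \<open>Zmod n\<close>.\<close>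
  define M where "M p = int (n div p)" for p
  define M' where "M' p = g p * M p mod int n" for p
  define Y where "Y p = (if p mod 3 = 1 then {M p, M' p} else {M p})" for p
  have pp: "prime (int p)" and pn: "p dvd n" and p1: "p > 1" if "p \<in> ?P" for p
    using that prime_gt_1_nat[OF in_prime_factors_imp_prime[OF that]] by auto
  have M: "\<not> int p dvd M p" if p: "p \<in> ?P" for p
  proof
    assume "int p dvd M p"
    then have "p * p dvd p * (n div p)"
      by (intro mult_dvd_mono) (simp_all add: M_def)
    then have "p ^ 2 dvd n"
      using pn[OF p] by (simp add: power2_eq_square)
    then show False
      using squarefreeD[OF sf] p1[OF p] by fastforce
  qed
  have M': "[M' p = g p * M p] (mod int p)" if p: "p \<in> ?P" for p
    using pn[OF p] by (simp add: M'_def cong_def mod_mod_cancel)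
  have Y_not_dvd: "\<not> int p dvd x" if p: "p \<in> ?P" and "x \<in> Y p" for p x
    using that M[OF p] cong_dvd_iff[OF M'[OF p]] g(1)[OF p] pp[OF p]
    by (auto simp: Y_def prime_dvd_mult_iff split: if_splits)
  have Y_dvd: "int q dvd x" if p: "p \<in> ?P" and q: "q \<in> ?P" and "q \<noteq> p" and x: "x \<in> Y p" for p q x
  proof -
    have "q dvd p * (n div p)"
      using pn[OF p] pn[OF q] by simp
    then have "q dvd n div p"
      using p q \<open>q \<noteq> p\<close> by (metis in_prime_factors_imp_prime prime_dvd_mult_iff primes_dvd_imp_eq)
    then have 1: "int q dvd M p"
      by (simp add: M_def)
    have "int q dvd M' p"
      using 1 pn[OF q] unfolding M'_def by (intro dvd_mod) simp_all
    then show ?thesis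
      using 1 x by (auto simp: Y_def split: if_splits)
  qed
  have Y_Zmod: "Y p \<subseteq> Zmod n" if p: "p \<in> ?P" for p
    using n0 p1[OF p] by (auto simp: Y_def Zmod_def M_def M'_def)
  have card_Y: "card (Y p) = cube_weight p" if p: "p \<in> ?P" for p
  proof (cases "p mod 3 = 1")
    case True
    have "M p \<noteq> M' p"
    proof
      assume "M p = M' p"
      then have "int p dvd g p * M p - M p"
        using M'[OF p] by (metis cong_iff_dvd_diff cong_sym)
      then have "int p dvd (g p - 1) * M p"
        by (simp add: algebra_simps)
      then have "int p dvd g p - 1"
        using M[OF p] pp[OF p] by (simp add: prime_dvd_mult_iff)
      \<comment> \<open>\<open>1 - g p\<close> is the value of \<open>u ^ 3 + g p * v ^ 3\<close> at
        \<open>u = 1\<close>, \<open>v = - 1\<close>.\<close>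
      then have "int p dvd - (g p - 1)"
        by (simp only: dvd_minus_iff)
      then show False
        using g(2)[OF p True, of 1 "- 1"] pp[OF p] by (simp add: prime_int_iff)
    qed
    then show ?thesis
      using True by (simp add: Y_def cube_weight_def)
  next
    case False
    then show ?thesis
      by (simp add: Y_def cube_weight_def)
  qed
  have finY: "finite (Y p)" for p
    by (simp add: Y_def)
  have disj: "Y p \<inter> Y q = {}" if "p \<in> ?P" "q \<in> ?P" "p \<noteq> q" for p q
    using Y_not_dvd[OF that(1)] Y_dvd[OF that(2,1,3)] by blast
  define X where "X = (\<Union>p\<in>?P. Y p)"
  have finX: "finite X"
    by (simp add: X_def finY)
  have zero: "0 \<notin> X"
    using Y_not_dvd by (auto simp: X_def)
  show thesis
  proof (rule that)
    show "X \<subseteq> Zmod n"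
      using Y_Zmod by (auto simp: X_def)
    show "0 \<notin> X"
      by (rule zero)
    have "card X = (\<Sum>p\<in>?P. card (Y p))"
      unfolding X_def using finY disj by (intro card_UN_disjoint) simp_all
    then show "card X = (\<Sum>p\<in>?P. cube_weight p)"
      using card_Y by simp
  next
    fix k S' assume sub: "S' \<subseteq># mset_set X + replicate_mset k 0"
      and "weighted_zero_sum n (unit_cubes n) S'"
    then obtain Z where Z: "image_mset snd Z = S'" "fst ` set_mset Z \<subseteq> unit_cubes n"
      "[(\<Sum>z\<in>#Z. fst z * snd z) = 0] (mod int n)"
      unfolding weighted_zero_sum_iff_pairs by blast
    show "set_mset S' \<subseteq> {0}"
    proof (rule ccontr)
      assume "\<not> set_mset S' \<subseteq> {0}"
      then obtain y where y: "y \<in># S'" "y \<noteq> 0"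
        by blast
      have S'X: "x \<in> insert 0 X" if "x \<in># S'" for x
        using mset_subset_eqD[OF sub that] finX by (auto split: if_splits)
      then obtain p where p: "p \<in> ?P" "y \<in> Y p"
        using y by (auto simp: X_def)
      \<comment> \<open>Terms outside \<open>Y p\<close> vanish modulo \<open>p\<close>, so the part
        \<open>?W\<close> inside \<open>Y p\<close> is itself a zero-sum modulo
        \<open>p\<close>.\<close>
      let ?in = "\<lambda>z. snd z \<in> Y p"
      let ?W = "filter_mset ?in Z"
      have "int p dvd (\<Sum>z\<in>#filter_mset (\<lambda>z. \<not> ?in z) Z. fst z * snd z)"
      proof (rule dvd_sum_mset)
        fix z assume "z \<in># filter_mset (\<lambda>z. \<not> ?in z) Z"
        then have z: "z \<in># Z" "snd z \<notin> Y p"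
          by auto
        then have "snd z \<in> insert 0 X"
          using S'X Z(1) by force
        then have "int p dvd snd z"
          using z(2) p(1) Y_dvd by (auto simp: X_def)
        then show "int p dvd fst z * snd z"
          by simp
      qed
      moreover have "int p dvd (\<Sum>z\<in>#Z. fst z * snd z)"
        using Z(3) pn[OF p(1)] by (auto simp: cong_0_iff elim: dvd_trans[rotated])
      moreover have "(\<Sum>z\<in>#Z. fst z * snd z) =
          (\<Sum>z\<in>#?W. fst z * snd z) + (\<Sum>z\<in>#filter_mset (\<lambda>z. \<not> ?in z) Z. fst z * snd z)"
        by (subst multiset_partition[of Z ?in]) (simp only: image_mset_union sum_mset.union)
      ultimately have dvd: "int p dvd (\<Sum>z\<in>#?W. fst z * snd z)"
        by (simp add: dvd_add_left_iff)
      have W_image: "image_mset snd ?W = filter_mset (\<lambda>x. x \<in> Y p) S'"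
        unfolding Z(1)[symmetric] by (simp add: filter_mset_image_mset)
      also have "\<dots> \<subseteq># filter_mset (\<lambda>x. x \<in> Y p) (mset_set X + replicate_mset k 0)"
        by (rule multiset_filter_mono[OF sub])
      also have "\<dots> = mset_set (Y p)"
      proof -
        have "{x \<in> X. x \<in> Y p} = Y p" "0 \<notin> Y p"
          using p(1) zero by (auto simp: X_def)
        then show ?thesis
          using finX by simp
      qed
      finally have subY: "image_mset snd ?W \<subseteq># mset_set (Y p)" .
      have weight: "\<exists>u. \<not> int p dvd u \<and> [fst z = u ^ 3] (mod int p)" if "z \<in># ?W" for z
      proof -
        have "fst z \<in> unit_cubes n" "prime p"
          using that Z(2) pp[OF p(1)] by auto
        then show ?thesis
          using unit_cubes_memE pn[OF p(1)] by blast
      qed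
      have not_single: "?W \<noteq> {#z#}" for z
      proof
        assume W: "?W = {#z#}"
        then have zW: "z \<in># ?W"
          by simp
        then have z: "snd z \<in> Y p"
          by simp
        obtain u where u: "\<not> int p dvd u" "[fst z = u ^ 3] (mod int p)"
          using weight[OF zW] by blast
        have "\<not> int p dvd fst z"
          using cong_dvd_iff[OF u(2)] u(1) pp[OF p(1)] by (simp add: prime_dvd_power_iff)
        then show False
          using dvd Y_not_dvd[OF p(1) z] pp[OF p(1)] unfolding W by (simp add: prime_dvd_mult_iff)
      qed
      have "y \<in># image_mset snd ?W"
        unfolding W_image using y p by simp
      then have "image_mset snd ?W \<noteq> {#}"
        by (metis empty_iff set_mset_empty)
      \<comment> \<open>With neither 0 nor 1 terms possible and at most \<open>cube_weight p\<close>
        available, \<open>?W\<close> must use both elements of \<open>Y p\<close>.\<close>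
      then have "size ?W \<noteq> 0"
        by simp
      moreover have "size ?W \<noteq> 1"
        using not_single size_1_singleton_mset by blast
      moreover have "size ?W \<le> cube_weight p"
        using size_mset_mono[OF subY] card_Y[OF p(1)] by simp
      moreover have "cube_weight p = (if p mod 3 = 1 then 2 else 1)"
        by (rule cube_weight_def)
      ultimately have p3: "p mod 3 = 1" and "size ?W = 2"
        by presburger+
      have card2: "card {M p, M' p} = 2"
        using card_Y[OF p(1)] p3 by (simp add: Y_def cube_weight_def)
      have "size (image_mset snd ?W) = size (mset_set (Y p))"
        using \<open>size ?W = 2\<close> card_Y[OF p(1)] p3 by (simp add: cube_weight_def)
      then have "image_mset snd ?W = mset_set (Y p)"
        using subY by (metis mset_subset_size less_irrefl subset_mset.le_imp_less_or_eq)
      also have "\<dots> = {#M p, M' p#}"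
        using p3 card2 by (auto simp: Y_def card_insert_if split: if_splits)
      finally have pair: "image_mset snd ?W = {#M p, M' p#}" .
      obtain z N where N: "?W = add_mset z N" "snd z = M p" "image_mset snd N = {#M' p#}"
        using msed_map_invR[OF pair] by blast
      obtain z' where "N = {#z'#}" "snd z' = M' p"
        using msed_map_invR[OF N(3)] by auto
      with N have W: "?W = {#z, z'#}" "snd z = M p" "snd z' = M' p"
        by simp_all
      obtain u u' where u: "\<not> int p dvd u" "[fst z = u ^ 3] (mod int p)"
        and u': "\<not> int p dvd u'" "[fst z' = u' ^ 3] (mod int p)"
        using weight[of z] weight[of z'] unfolding W(1) by auto
      \<comment> \<open>Factoring out \<open>M p\<close> leaves a value excluded by the choice of
        \<open>g p\<close>.\<close>
      have cong: "[fst z * M p + fst z' * M' p = u ^ 3 * M p + u' ^ 3 * (g p * M p)] (mod int p)"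
        by (intro cong_add cong_mult u u' cong_refl M' p)
      then have "int p dvd u ^ 3 * M p + u' ^ 3 * (g p * M p)"
        using dvd W cong_dvd_iff[OF cong] by simp
      moreover have "u ^ 3 * M p + u' ^ 3 * (g p * M p) = M p * (u ^ 3 + g p * u' ^ 3)"
        by (simp add: algebra_simps)
      ultimately show False
        using M[OF p(1)] g(2)[OF p(1) p3 u(1)] pp[OF p(1)] by (simp add: prime_dvd_mult_iff)
    qed
  qed
qed

section \<open>The two constants in terms of the prime factors\<close>

text \<open>The existence of zero-sums of length \<open>n\<close> gives both upper bounds, for the
  Davenport constant after padding with \<open>n - 1\<close> zeros. The free set \<open>X\<close>,
  with or without zeros, gives both lower bounds.\<close>

lemma weighted_constants_unit_cubes:
  fixes n :: nat
  assumes sf: "squarefree n" and n: "odd n" "\<not> 3 dvd n" "\<not> 7 dvd n" "\<not> 13 dvd n"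
  defines "L \<equiv> (\<Sum>p\<in>prime_factors n. cube_weight p)"
  shows "weighted_Davenport n (unit_cubes n) = L + 1"
    and "weighted_EGZ n (unit_cubes n) = n + L"
proof -
  have n0: "n > 0"
    using n(1) by (simp add: odd_pos)
  obtain X where X: "X \<subseteq> Zmod n" "0 \<notin> X" "card X = L"
    and free: "\<And>k S'. S' \<subseteq># mset_set X + replicate_mset k 0 \<Longrightarrow>
      weighted_zero_sum n (unit_cubes n) S' \<Longrightarrow> set_mset S' \<subseteq> {0}"
    using exists_cube_weighted_zero_sum_free_set[OF sf] unfolding L_def by blast
  have finX: "finite X"
    using X(1) finite_subset by (fastforce simp: Zmod_def)
  have sub_X: "mset_set X' \<subseteq># mset_set X" if "X' \<subseteq> X" for X'
    using that finX finite_subset msubset_mset_set_iff by blast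
  have upper: "\<exists>S'. S' \<subseteq># S \<and> size S' = n \<and> weighted_zero_sum n (unit_cubes n) S'"
    if "size S = n + L" for S
    using that exists_cube_weighted_zero_sum_length_n[OF sf n] by (simp add: L_def)
  show "weighted_EGZ n (unit_cubes n) = n + L"
    unfolding weighted_EGZ_def
  proof (rule Least_equality)
    show "0 < n + L \<and> (\<forall>S. set_mset S \<subseteq> Zmod n \<and> size S = n + L \<longrightarrow>
        (\<exists>S'. S' \<subseteq># S \<and> size S' = n \<and> weighted_zero_sum n (unit_cubes n) S'))"
      using upper n0 by simp
  next
    fix l assume l: "0 < l \<and> (\<forall>S. set_mset S \<subseteq> Zmod n \<and> size S = l \<longrightarrow>
        (\<exists>S'. S' \<subseteq># S \<and> size S' = n \<and> weighted_zero_sum n (unit_cubes n) S'))"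
    show "n + L \<le> l"
    proof (rule ccontr)
      assume "\<not> n + L \<le> l"
      \<comment> \<open>Up to \<open>n - 1\<close> terms are zeros and the rest come from
        \<open>X\<close>; truncated subtraction covers \<open>l < n\<close>. A zero-sum of length
        \<open>n\<close> would need \<open>n\<close> zeros.\<close>
      then have "l - (n - 1) \<le> card X" "l - (l - (n - 1)) \<le> n - 1"
        using n0 X(3) by linarith+
      then obtain X' where X': "X' \<subseteq> X" "card X' = l - (n - 1)"
        by (metis obtain_subset_with_card_n)
      define k where "k = l - card X'"
      let ?S = "mset_set X' + replicate_mset k (0 :: int)"
      have k: "k \<le> n - 1" "card X' + k = l"
        using X'(2) by (auto simp: k_def)
      have "set_mset ?S \<subseteq> Zmod n"
        using X(1) X'(1) n0 by (cases "finite X'") (auto simp: Zmod_def split: if_splits)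
      moreover have "size ?S = l"
        using k by simp
      ultimately obtain S' where S': "S' \<subseteq># ?S" "size S' = n" "weighted_zero_sum n (unit_cubes n) S'"
        using l by blast
      have "S' \<subseteq># mset_set X + replicate_mset k 0"
        using S'(1) sub_X[OF X'(1)] by (meson subset_mset.add_right_mono subset_mset.order_trans)
      then have "set_mset S' \<subseteq> {0}"
        using free S'(3) by blast
      then have "S' = replicate_mset n 0"
        using S'(2) by (metis set_mset_subset_singletonD)
      then have "n \<le> count ?S 0"
        using mset_subset_eq_count[OF S'(1), of 0] by simp
      also have "\<dots> = k"
        using X(2) X'(1) by (auto simp: count_mset_set')
      finally show False
        using k n0 by linarith
    qed
  qed
  show "weighted_Davenport n (unit_cubes n) = L + 1"
    unfolding weighted_Davenport_def
  proof (rule Least_equality)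
    have "\<exists>S'. S' \<subseteq># S \<and> S' \<noteq> {#} \<and> weighted_zero_sum n (unit_cubes n) S'" if S: "size S = L + 1" for S
    proof (cases "0 \<in># S")
      case True
      have "weighted_zero_sum n (unit_cubes n) {#0#}"
        unfolding weighted_zero_sum_iff_pairs using unit_cubes_memI[OF n0, of 1]
        by (intro exI[of _ "{#(1 ^ 3 mod int n, 0)#}"]) simp
      then show ?thesis
        using True by (intro exI[of _ "{#0#}"]) simp
    next
      case False
      \<comment> \<open>Fewer than \<open>n\<close> zeros are added, so a zero-sum of length
        \<open>n\<close> contains a term of \<open>S\<close>; deleting its zeros leaves a nonempty
        zero-sum within \<open>S\<close>.\<close>
      let ?T = "S + replicate_mset (n - 1) 0"
      have "size ?T = n + L"
        using S n0 by simp
      then obtain S' where S': "S' \<subseteq># ?T" "size S' = n" "weighted_zero_sum n (unit_cubes n) S'"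
        using upper by blast
      let ?S' = "filter_mset (\<lambda>x. x \<noteq> 0) S'"
      have "?S' \<subseteq># filter_mset (\<lambda>x. x \<noteq> 0) ?T"
        by (rule multiset_filter_mono[OF S'(1)])
      also have "\<dots> = S"
      proof -
        have "filter_mset (\<lambda>x. x \<noteq> 0) S = S"
          using False by (auto simp: filter_mset_eq_conv)
        moreover have "filter_mset (\<lambda>x. x \<noteq> 0) (replicate_mset k (0 :: int)) = {#}" for k
          by (induction k) simp_all
        ultimately show ?thesis
          by simp
      qed
      finally have "?S' \<subseteq># S" .
      moreover have "?S' \<noteq> {#}"
      proof
        assume "?S' = {#}"
        then have "set_mset S' \<subseteq> {0}"
          by auto
        then have "S' = replicate_mset n 0"
          using S'(2) by (metis set_mset_subset_singletonD)
        then have "n \<le> count ?T 0"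
          using mset_subset_eq_count[OF S'(1), of 0] by simp
        then show False
          using False n0 by (simp add: not_in_iff)
      qed
      ultimately show ?thesis
        using weighted_zero_sum_filter_nonzero[OF S'(3)] by blast
    qed
    then show "0 < L + 1 \<and> (\<forall>S. set_mset S \<subseteq> Zmod n \<and> size S = L + 1 \<longrightarrow>
        (\<exists>S'. S' \<subseteq># S \<and> S' \<noteq> {#} \<and> weighted_zero_sum n (unit_cubes n) S'))"
      by simp
  next
    fix l assume l: "0 < l \<and> (\<forall>S. set_mset S \<subseteq> Zmod n \<and> size S = l \<longrightarrow>
        (\<exists>S'. S' \<subseteq># S \<and> S' \<noteq> {#} \<and> weighted_zero_sum n (unit_cubes n) S'))"
    show "L + 1 \<le> l"
    proof (rule ccontr)
      assume "\<not> L + 1 \<le> l"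
      \<comment> \<open>Distinct elements of \<open>X\<close> without padding, the case
        \<open>k = 0\<close>, have no nonempty zero-sum, so every length up to \<open>L\<close>
        fails.\<close>
      then have "l \<le> card X"
        using X(3) by simp
      then obtain X' where X': "X' \<subseteq> X" "card X' = l" "finite X'"
        by (metis obtain_subset_with_card_n)
      have "set_mset (mset_set X') \<subseteq> Zmod n"
        using X(1) X' by auto
      moreover have "size (mset_set X') = l"
        using X'(2) by simp
      ultimately obtain S' where S': "S' \<subseteq># mset_set X'" "S' \<noteq> {#}" "weighted_zero_sum n (unit_cubes n) S'"
        using l by blast
      have "S' \<subseteq># mset_set X + replicate_mset 0 0"
        using S'(1) sub_X[OF X'(1)] by auto
      then have "set_mset S' \<subseteq> {0}"
        using free S'(3) by blast
      moreover have "set_mset S' \<subseteq> X"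
        using set_mset_mono[OF S'(1)] X' by auto
      ultimately show False
        using X(2) S'(2) by (metis set_mset_eq_empty_iff subset_empty subset_singletonD insert_subset)
    qed
  qed
qed

lemma prime_factors_prod_primes:
  fixes f :: "nat \<Rightarrow> nat"
  assumes "finite A" "\<And>i. i \<in> A \<Longrightarrow> prime (f i)"
  shows "prime_factors (\<Prod>i\<in>A. f i) = f ` A"
proof -
  have "f i \<noteq> 0" if "i \<in> A" for i
    using prime_gt_0_nat[OF assms(2)[OF that]] by simp
  then have "0 \<notin> f ` A"
    by force
  then show ?thesis
    using assms by (auto simp: prime_factors_prod prime_prime_factors)
qed

theorem theorem1p1:
  fixes n n1 n2 r s :: nat and p q :: "nat \<Rightarrow> nat"
  assumes "n = n1 * n2"
    and "squarefree n" and "odd n" and "\<not> 7 dvd n" and "\<not> 13 dvd n"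
    and "n1 = (\<Prod>i=1..r. p i)" and "n2 = (\<Prod>j=1..s. q j)"
    and "\<And>i. i \<in> {1..r} \<Longrightarrow> prime (p i) \<and> [p i = 1] (mod 3)"
    and "\<And>j. j \<in> {1..s} \<Longrightarrow> prime (q j) \<and> [q j = 2] (mod 3)"
  shows "weighted_Davenport n (unit_cubes n) = 2 * Omega n1 + Omega n2 + 1 \<and>
         weighted_EGZ n (unit_cubes n) = n + 2 * Omega n1 + Omega n2"
proof -
  have sf: "squarefree n1" "squarefree n2"
    using assms(1,2) squarefree_multD by blast+
  then have nz: "n1 \<noteq> 0" "n2 \<noteq> 0"
    by (metis not_squarefree_0)+
  have P: "prime_factors n1 = p ` {1..r}" "prime_factors n2 = q ` {1..s}"
    unfolding assms(6,7) using assms(8,9) by (intro prime_factors_prod_primes; simp)+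
  have mod3: "x mod 3 = 1" if "x \<in> prime_factors n1" for x
    using that assms(8) unfolding P by (fastforce simp: cong_def)
  have mod3': "x mod 3 = 2" if "x \<in> prime_factors n2" for x
    using that assms(9) unfolding P by (fastforce simp: cong_def)
  have PF: "prime_factors n = prime_factors n1 \<union> prime_factors n2"
    unfolding assms(1) using nz by (rule prime_factors_product)
  \<comment> \<open>3 lies in neither of the two residue classes.\<close>
  have "3 \<notin> prime_factors n"
    unfolding PF using mod3[of 3] mod3'[of 3] by auto
  then have "\<not> 3 dvd n"
    using nz assms(1) by (auto simp: in_prime_factors_iff)
  note main = weighted_constants_unit_cubes[OF assms(2,3) this assms(4,5)]
  \<comment> \<open>Residues modulo 3 separate the prime factors of \<open>n1\<close> from those of
    \<open>n2\<close>; squarefreeness turns the two cardinalities into \<open>Omega\<close>.\<close>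
  have "(\<Sum>x\<in>prime_factors n. cube_weight x) =
      (\<Sum>x\<in>prime_factors n1. cube_weight x) + (\<Sum>x\<in>prime_factors n2. cube_weight x)"
    unfolding PF using mod3 mod3' by (intro sum.union_disjoint) fastforce+
  also have "(\<Sum>x\<in>prime_factors n1. cube_weight x) = 2 * card (prime_factors n1)"
    using mod3 by (simp add: cube_weight_def)
  also have "(\<Sum>x\<in>prime_factors n2. cube_weight x) = card (prime_factors n2)"
    using mod3' by (simp add: cube_weight_def)
  also have "card (prime_factors n1) = Omega n1"
    by (rule Omega_squarefree[OF sf(1), symmetric])
  also have "card (prime_factors n2) = Omega n2"
    by (rule Omega_squarefree[OF sf(2), symmetric])
  finally show ?thesis
    using main by simp
qed

end
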